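(* For every $k\in\mathbb N_+$ there exists $\phi\in\mathrm{Hom}^+(\mathcal A[T_{k\text{-Hypergraph}}],\mathbb R)$ satisfying $\mathrm{Dev}[k-1]$ (i.e. $\mathrm{Disc}[\mathcal A_{k-1}]$ with $\mathcal A_{k-1}=\{A\subseteq[k]:|A|=k-1,\ 1\in A\}$) but not satisfying $\mathrm{UInduce}[1]$.
   Context: All languages are finite relational. A canonical theory over $\mathcal L$ is a universal theory containing, for each $P\in\mathcal L$, the axiom that $P(x_1,\dots,x_{k(P)})$ fails whenever two $x_i$ coincide; $T_{\mathcal L}$ is the canonical theory with only these axioms. $T_{k\text{-Hypergraph}}$: single $k$-ary predicate $E$ with symmetry axioms; $\rho_k$ is the $k$-vertex hypergraph with one edge. $T\cup T'$: disjoint union. $\mathcal M[T]$: isomorphism classes of finite models. $\mathrm{Hom}^+(\mathcal A[T],\mathbb R)$: functions $\phi:\mathcal M[T]\to[0,1]$, $\phi(M)=\lim_n p(M,N_n)$ for finite models $N_n$ of $T$ of strictly increasing size ($p(M,N)$ = probability a random $|M|$-subset of $V(N)$ induces a copy of $M$). $\phi(\langle K\rangle)=\frac{|\mathrm{Aut}(K)|}{|K|!}\phi([K])$. Exchangeable array: every $\xi\in\mathrm{Hom}^+(\mathcal A[T],\mathbb R)$ is represented by a $T$-on, i.e. measurable sets $\mathcal N_P\subseteq[0,1]^{r([k(P)])}$ ($r(V)$ = finite nonempty subsets of $V$) such that for $\theta$ uniform in $[0,1]^{r(\mathbb N_+)}$, the structure $\mathbf K$ on $\mathbb N_+$ with $R_P(\mathbf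 K)=\{\alpha\text{ injective}:(\theta_{\alpha(A)})_A\in\mathcal N_P\}$ is a.s. a model of $T$ and $\xi(M)=\Pr[\mathbf K|_{[|M|]}\cong M]$; $\mathbf K$ is the exchangeable array associated with $\xi$ (its law depends only on $\xi$). Coupling of $\phi$ (theory $T$) and $\psi$ (theory $T'$): $\xi$ on $T\cup T'$ whose reducts are $\phi,\psi$; independent coupling $(\phi\otimes\psi)(\langle M\rangle)=\phi(\langle M|_T\rangle)\psi(\langle M|_{T'}\rangle)$. $\mathrm{Disc}[\mathcal A]$ for an antichain $\mathcal A$ of nonempty subsets of $[k]$: let $\mathcal L_{\mathcal A}$ have a predicate $P_A$ of arity $|A|$ for each $A\in\mathcal A$, and $\iota_A:[|A|]\to[k]$ the increasing enumeration of $A$. $\phi$ satisfies $\mathrm{Disc}[\mathcal A]$ if for every $\psi\in\mathrm{Hom}^+(\mathcal A[T_{\mathcal L_{\mathcal A}}],\mathbb R)$ and every coupling $\xi$ of $\phi$ and $\psi$, with $\mathbf K$ the exchangeable array of $\xi$, $\Pr[(1,\dots,k)\in R_E(\mathbf K)\wedge\forall A\in\mathcal A,\ \iota_A\in R_{P_A}(\mathbf K)]=\phi(\rho_k)\Pr[\forall A\in\mathcal A,\ \iota_A\in R_{P_A}(\mathbf K)]$. The property $\mathrm{Dev}[k-1]$ is $\mathrm{Disc}[\mathcal A_{k-1}]$. $\mathrm{UInduce}[1]$: for every $\psi\in\mathrm{Hom}^+(\mathcal A[T_{1\text{-Hypergraph}}],\mathbb R)$ (a 1-hypergraph is a vertex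 subset), every coupling $\xi$ of $\phi$ and $\psi$, and every $M\in\mathcal M[T_{k\text{-Hypergraph}}\cup T_{1\text{-Hypergraph}}]$ in which every vertex lies in the 1-hypergraph, $\xi(M)=(\phi\otimes\psi)(M)$. *)

theory Defs
  imports "HOL-Probability.Probability"
begin

text \<open>
  Conventions. Numbering is zero-based: \<open>[k]\<close> is \<open>{..<k}\<close>, the vertex set
  of an exchangeable array is all of \<^typ>\<open>nat\<close>, and the distinguished element
  \<open>1 \<in> [k]\<close> becomes \<open>0\<close>. A tuple \<open>\<alpha> : [k] \<rightarrow> V\<close> is a list of length
  \<open>k\<close>. Finite vertex sets are taken inside \<^typ>\<open>nat\<close>, which loses nothing up to isomorphism.
\<close>

section \<open>Canonical theories and their models\<close>

record 'p struc =
  verts :: "nat set"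
  rels :: "'p \<Rightarrow> nat list set"

text \<open>
  A canonical theory is given by its language and by the condition that its axioms, other
  than the non-degeneracy axioms of every canonical theory, impose on a structure.
\<close>

record 'p canon_thy =
  syms :: "'p set"
  arity :: "'p \<Rightarrow> nat"
  ax :: "'p struc \<Rightarrow> bool"

definition is_structure :: "'p canon_thy \<Rightarrow> 'p struc \<Rightarrow> bool" where
  "is_structure T M \<longleftrightarrow>
     (\<forall>P\<in>syms T. \<forall>xs\<in>rels M P. length xs = arity T P \<and> set xs \<subseteq> verts M) \<and>
     (\<forall>P. P \<notin> syms T \<longrightarrow> rels M P = {})"

definition model :: "'p canon_thy \<Rightarrow> 'p struc \<Rightarrow> bool" where
  "model T M \<longleftrightarrow> is_structure T M \<and> (\<forall>P\<in>syms T. \<forall>xs\<in>rels M P. distinct xs) \<and> ax T M"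

definition fin_model :: "'p canon_thy \<Rightarrow> 'p struc \<Rightarrow> bool" where
  "fin_model T M \<longleftrightarrow> model T M \<and> finite (verts M)"

definition is_iso :: "(nat \<Rightarrow> nat) \<Rightarrow> 'p struc \<Rightarrow> 'p struc \<Rightarrow> bool" where
  "is_iso f M N \<longleftrightarrow> bij_betw f (verts M) (verts N) \<and>
     (\<forall>P xs. set xs \<subseteq> verts M \<longrightarrow> (xs \<in> rels M P \<longleftrightarrow> map f xs \<in> rels N P))"

definition isomorphic :: "'p struc \<Rightarrow> 'p struc \<Rightarrow> bool" where
  "isomorphic M N \<longleftrightarrow> (\<exists>f. is_iso f M N)"

definition aut :: "'p struc \<Rightarrow> (nat \<Rightarrow> nat) set" where
  "aut M = {f. f permutes verts M \<and> is_iso f M M}"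

definition induced :: "'p struc \<Rightarrow> nat set \<Rightarrow> 'p struc" where
  "induced M W = \<lparr>verts = verts M \<inter> W, rels = (\<lambda>P. {xs \<in> rels M P. set xs \<subseteq> W})\<rparr>"

definition iso_class :: "'p canon_thy \<Rightarrow> 'p struc \<Rightarrow> 'p struc set" where
  "iso_class T M = {N. fin_model T N \<and> isomorphic M N}"

text \<open>The set \<open>\<M>[T]\<close>.\<close>

definition iso_classes :: "'p canon_thy \<Rightarrow> 'p struc set set" where
  "iso_classes T = iso_class T ` {M. fin_model T M}"

definition pure_thy :: "'p set \<Rightarrow> ('p \<Rightarrow> nat) \<Rightarrow> 'p canon_thy" where
  "pure_thy S ar = \<lparr>syms = S, arity = ar, ax = (\<lambda>_. True)\<rparr>"

definition hypergraph_thy :: "nat \<Rightarrow> unit canon_thy" where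
  "hypergraph_thy k = \<lparr>syms = UNIV, arity = (\<lambda>_. k),
     ax = (\<lambda>M. \<forall>xs ys. xs \<in> rels M () \<and> mset ys = mset xs \<longrightarrow> ys \<in> rels M ())\<rparr>"

definition single_edge :: "nat \<Rightarrow> unit struc" where
  "single_edge k = \<lparr>verts = {..<k}, rels = (\<lambda>_. {xs. distinct xs \<and> set xs = {..<k}})\<rparr>"

definition reductL :: "('p + 'q) struc \<Rightarrow> 'p struc" where
  "reductL M = \<lparr>verts = verts M, rels = (\<lambda>P. rels M (Inl P))\<rparr>"

definition reductR :: "('p + 'q) struc \<Rightarrow> 'q struc" where
  "reductR M = \<lparr>verts = verts M, rels = (\<lambda>Q. rels M (Inr Q))\<rparr>"

definition union_thy :: "'p canon_thy \<Rightarrow> 'q canon_thy \<Rightarrow> ('p + 'q) canon_thy" where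
  "union_thy T T' = \<lparr>syms = syms T <+> syms T', arity = case_sum (arity T) (arity T'),
     ax = (\<lambda>M. ax T (reductL M) \<and> ax T' (reductR M))\<rparr>"

section \<open>Limit objects\<close>

definition ind_density :: "'p struc \<Rightarrow> 'p struc \<Rightarrow> real" where
  "ind_density M N =
     real (card {W. W \<subseteq> verts N \<and> card W = card (verts M) \<and> isomorphic (induced N W) M}) /
     real (card (verts N) choose card (verts M))"

text \<open>
  The set \<open>Hom\<^sup>+(\<A>[T], \<real>)\<close>. Only the values of a function on \<^term>\<open>iso_classes T\<close> are
  relevant, here and below.
\<close>

definition hom_plus :: "'p canon_thy \<Rightarrow> ('p struc set \<Rightarrow> real) set" where
  "hom_plus T = {\<phi>. \<phi> \<in> iso_classes T \<rightarrow> {0..1} \<and>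
     (\<exists>N. (\<forall>n. fin_model T (N n)) \<and> strict_mono (\<lambda>n::nat. card (verts (N n))) \<and>
          (\<forall>M. fin_model T M \<longrightarrow> (\<lambda>n. ind_density M (N n)) \<longlonglongrightarrow> \<phi> (iso_class T M)))}"

text \<open>The labelled value \<open>\<phi>(\<langle>K\<rangle>)\<close>.\<close>

definition labelled :: "'p canon_thy \<Rightarrow> ('p struc set \<Rightarrow> real) \<Rightarrow> 'p struc \<Rightarrow> real" where
  "labelled T \<phi> K = real (card (aut K)) / fact (card (verts K)) * \<phi> (iso_class T K)"

text \<open>
  The reduct of \<open>\<xi>\<close> to \<open>T\<close> takes at \<open>M\<close> the sum of \<open>\<xi>\<close> over all isomorphism classes of
  models of the union whose reduct to \<open>T\<close> is isomorphic to \<open>M\<close>.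
\<close>

definition coupling :: "'p canon_thy \<Rightarrow> 'q canon_thy \<Rightarrow> ('p struc set \<Rightarrow> real) \<Rightarrow>
    ('q struc set \<Rightarrow> real) \<Rightarrow> (('p + 'q) struc set \<Rightarrow> real) \<Rightarrow> bool" where
  "coupling T T' \<phi> \<psi> \<xi> \<longleftrightarrow> \<xi> \<in> hom_plus (union_thy T T') \<and>
     (\<forall>M. fin_model T M \<longrightarrow> \<phi> (iso_class T M) =
        (\<Sum>C | C \<in> iso_classes (union_thy T T') \<and> (\<exists>N\<in>C. isomorphic (reductL N) M). \<xi> C)) \<and>
     (\<forall>M. fin_model T' M \<longrightarrow> \<psi> (iso_class T' M) =
        (\<Sum>C | C \<in> iso_classes (union_thy T T') \<and> (\<exists>N\<in>C. isomorphic (reductR N) M). \<xi> C))"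

text \<open>
  The value \<open>(\<phi> \<otimes> \<psi>)([M])\<close>: the labelled value is the product of the labelled values of the
  reducts, and dividing by \<open>\<bar>Aut(M)\<bar> / \<bar>M\<bar>!\<close> turns it into the unlabelled one.
\<close>

definition indep_coupling :: "'p canon_thy \<Rightarrow> 'q canon_thy \<Rightarrow> ('p struc set \<Rightarrow> real) \<Rightarrow>
    ('q struc set \<Rightarrow> real) \<Rightarrow> ('p + 'q) struc \<Rightarrow> real" where
  "indep_coupling T T' \<phi> \<psi> M =
     labelled T \<phi> (reductL M) * labelled T' \<psi> (reductR M) /
     (real (card (aut M)) / fact (card (verts M)))"

section \<open>Exchangeable arrays\<close>

definition nonempty_fin :: "nat set \<Rightarrow> nat set set" where
  "nonempty_fin V = {A. finite A \<and> A \<noteq> {} \<and> A \<subseteq> V}"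

text \<open>The cube \<open>[0,1]\<close> to the power \<open>r(V)\<close> with the uniform measure on it.\<close>

definition cube :: "nat set \<Rightarrow> (nat set \<Rightarrow> real) measure" where
  "cube V = PiM (nonempty_fin V) (\<lambda>_. restrict_space lborel {0..1})"

definition array :: "'p canon_thy \<Rightarrow> ('p \<Rightarrow> (nat set \<Rightarrow> real) set) \<Rightarrow> (nat set \<Rightarrow> real) \<Rightarrow>
    'p struc" where
  "array T \<N> \<theta> = \<lparr>verts = UNIV,
     rels = (\<lambda>P. {\<alpha>. P \<in> syms T \<and> length \<alpha> = arity T P \<and> distinct \<alpha> \<and>
        (\<lambda>A\<in>nonempty_fin {..<arity T P}. \<theta> ((\<lambda>i. \<alpha> ! i) ` A)) \<in> \<N> P})\<rparr>"

text \<open>The family \<open>\<N>\<close> is a \<open>T\<close>-on, and \<open>\<xi>\<close> is the limit object that it represents.\<close>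

definition represents :: "'p canon_thy \<Rightarrow> ('p \<Rightarrow> (nat set \<Rightarrow> real) set) \<Rightarrow>
    ('p struc set \<Rightarrow> real) \<Rightarrow> bool" where
  "represents T \<N> \<xi> \<longleftrightarrow>
     (\<forall>P\<in>syms T. \<N> P \<in> sets (cube {..<arity T P})) \<and>
     (AE \<theta> in cube UNIV. model T (array T \<N> \<theta>)) \<and>
     (\<forall>M. fin_model T M \<longrightarrow> \<xi> (iso_class T M) =
        \<P>(\<theta> in cube UNIV. isomorphic (induced (array T \<N> \<theta>) {..<card (verts M)}) M))"

section \<open>Quasirandomness properties\<close>

text \<open>
  Disc for a family \<open>\<A>\<close> of nonempty subsets of \<open>[k]\<close> (an antichain in all applications).
  The language has one predicate for each \<open>A \<in> \<A>\<close>, named \<open>A\<close> itself. The exchangeable array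
  of \<open>\<xi>\<close> is that of any \<open>T\<close>-on representing \<open>\<xi>\<close>: such a \<open>T\<close>-on always exists and the law
  of the array does not depend on its choice.
\<close>

definition Disc :: "nat \<Rightarrow> nat set set \<Rightarrow> (unit struc set \<Rightarrow> real) \<Rightarrow> bool" where
  "Disc k \<A> \<phi> \<longleftrightarrow>
     (let T = hypergraph_thy k; T' = pure_thy \<A> card; U = union_thy T T' in
      \<forall>\<psi> \<in> hom_plus T'. \<forall>\<xi>. coupling T T' \<phi> \<psi> \<xi> \<longrightarrow>
        (\<forall>\<N>. represents U \<N> \<xi> \<longrightarrow>
           \<P>(\<theta> in cube UNIV. [0..<k] \<in> rels (array U \<N> \<theta>) (Inl ()) \<and>
              (\<forall>A\<in>\<A>. sorted_list_of_set A \<in> rels (array U \<N> \<theta>) (Inr A))) =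
           \<phi> (iso_class T (single_edge k)) *
           \<P>(\<theta> in cube UNIV. \<forall>A\<in>\<A>. sorted_list_of_set A \<in> rels (array U \<N> \<theta>) (Inr A))))"

text \<open>The property \<open>Dev[k - 1]\<close>. For \<open>k = 1\<close> the family is empty.\<close>

definition Dev_km1 :: "nat \<Rightarrow> (unit struc set \<Rightarrow> real) \<Rightarrow> bool" where
  "Dev_km1 k \<phi> \<longleftrightarrow> Disc k {A. A \<subseteq> {..<k} \<and> card A = k - 1 \<and> 0 \<in> A} \<phi>"

definition UInduce1 :: "nat \<Rightarrow> (unit struc set \<Rightarrow> real) \<Rightarrow> bool" where
  "UInduce1 k \<phi> \<longleftrightarrow>
     (let T = hypergraph_thy k; T' = hypergraph_thy 1; U = union_thy T T' in
      \<forall>\<psi> \<in> hom_plus T'. \<forall>\<xi>. coupling T T' \<phi> \<psi> \<xi> \<longrightarrow>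
        (\<forall>M. fin_model U M \<and> (\<forall>v\<in>verts M. [v] \<in> rels M (Inr ())) \<longrightarrow>
           \<xi> (iso_class U M) = indep_coupling T T' \<phi> \<psi> M))"

end

theory Submission
  imports Defs
begin

text \<open>
  Split the vertices into marked and unmarked ones, give every \<open>(k - 1)\<close>-set of vertices a random
  sign, and let a \<open>k\<close>-set be an edge iff the product of the signs of its \<open>(k - 1)\<close>-subsets is
  \<open>-1\<close>, except that this is reversed if none of its vertices is marked. Any \<open>k + 1\<close> marked vertices
  span an even number of edges, whereas any \<open>k + 1\<close> vertices exactly one of which is marked span an
  odd number. So the set of marked vertices refutes UInduce.

  The sets in the family defining Dev all contain the first vertex. Eliminating their predicates one
  by one, by the Cauchy--Schwarz inequality in the exchangeable array, doubles the other vertices and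
  bounds the correlation of the edge sign \<open>s\<close> with the predicates by the average of a product of
  \<open>s\<close> over the \<open>2\<^sup>k\<^sup>-\<^sup>1\<close> edges of an octahedron. The \<open>(k - 1)\<close>-set avoiding the first vertex lies in
  only one of these edges, so its random sign makes the average vanish. Because the bound is on an even
  power, it suffices that the average is not positive, so it is enough to choose, for each
  finite vertex set, signs for which the average is at most its mean.
\<close>

section \<open>Isomorphism\<close>

text \<open>Dev quantifies over all couplings and all representing families \<open>\<N>\<close>,
  whereas the construction controls \<open>\<phi>\<close> alone. So the elimination must end in a
  quantity determined by \<open>\<phi>\<close>: once every predicate is gone, the octahedral average
  is an isomorphism-invariant statistic of 2k vertices of the hypergraph, and an inequality checked
  in each finite hypergraph passes to the limit. No random limit object is built. Signs are fixed
  for each size, and compactness of the densities gives one subsequence along which the hypergraphs,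
  the marked sets and the pairs of both converge, so that Dev and the failure of UInduce concern the
  same \<open>\<phi>\<close>. Cauchy--Schwarz is done without conditioning: a vertex is replaced by
  n fresh vertices, exchangeability makes all the resulting correlations equal, and n tends to
  infinity. The edge density 1/2 is not computed from the construction; it is the case of trivial
  predicates of the orthogonality that proves Dev. For k = 1 the family of Dev is empty, and the
  property reduces to the meaning of the edge density.\<close>

lemma isomorphic_refl [simp]: "isomorphic M M"
  unfolding isomorphic_def is_iso_def by (rule exI[of _ id]) auto

lemma isomorphic_sym: 
  assumes "isomorphic M N" shows "isomorphic N M"
proof -
  from assms obtain f where f: "bij_betw f (verts M) (verts N)"
    and r: "\<And>P xs. set xs \<subseteq> verts M \<Longrightarrow> (xs \<in> rels M P \<longleftrightarrow> map f xs \<in> rels N P)"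
    unfolding isomorphic_def is_iso_def by auto
  let ?g = "inv_into (verts M) f"
  have g: "bij_betw ?g (verts N) (verts M)" using f by (rule bij_betw_inv_into)
  have "is_iso ?g N M"
    unfolding is_iso_def
  proof (intro conjI allI impI g)
    fix P xs assume xs: "set xs \<subseteq> verts N"
    have "set (map ?g xs) \<subseteq> verts M" using g xs by (auto simp: bij_betw_def)
    from r[OF this, of P] have "map ?g xs \<in> rels M P \<longleftrightarrow> map f (map ?g xs) \<in> rels N P" .
    also have "map f (map ?g xs) = xs"
      using xs f by (auto simp: bij_betw_def f_inv_into_f intro!: map_idI)
    finally show "xs \<in> rels N P \<longleftrightarrow> map ?g xs \<in> rels M P" by simp
  qed
  then show ?thesis unfolding isomorphic_def by blast
qed

lemma isomorphic_trans [trans]: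
  assumes "isomorphic L M" "isomorphic M N" shows "isomorphic L N"
proof -
  from assms obtain f g where f: "is_iso f L M" and g: "is_iso g M N"
    unfolding isomorphic_def by auto
  have "is_iso (g \<circ> f) L N"
    unfolding is_iso_def
  proof (intro conjI allI impI)
    show "bij_betw (g \<circ> f) (verts L) (verts N)"
      using f g unfolding is_iso_def by (blast intro: bij_betw_trans)
    fix P xs assume xs: "set xs \<subseteq> verts L"
    then have "set (map f xs) \<subseteq> verts M" using f by (auto simp: is_iso_def bij_betw_def)
    then show "xs \<in> rels L P \<longleftrightarrow> map (g \<circ> f) xs \<in> rels N P"
      using f g xs unfolding is_iso_def by (metis map_map)
  qed
  then show ?thesis unfolding isomorphic_def by blast
qed

lemma isomorphic_card: "isomorphic M N \<Longrightarrow> card (verts M) = card (verts N)"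
  unfolding isomorphic_def is_iso_def by (auto intro: bij_betw_same_card)

lemma isomorphic_cong_left: "isomorphic M M' \<Longrightarrow> isomorphic M N \<longleftrightarrow> isomorphic M' N"
  using isomorphic_sym isomorphic_trans by blast

lemma isomorphic_cong_right: "isomorphic M M' \<Longrightarrow> isomorphic N M \<longleftrightarrow> isomorphic N M'"
  using isomorphic_sym isomorphic_trans by blast

lemma isomorphic_reductL: "isomorphic M N \<Longrightarrow> isomorphic (reductL M) (reductL N)"
  unfolding isomorphic_def is_iso_def reductL_def by auto

lemma isomorphic_reductR: "isomorphic M N \<Longrightarrow> isomorphic (reductR M) (reductR N)"
  unfolding isomorphic_def is_iso_def reductR_def by auto

lemma mem_iso_class: "N \<in> iso_class T M \<longleftrightarrow> fin_model T N \<and> isomorphic M N"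
  by (simp add: iso_class_def)

lemma iso_class_eq_iff:
  assumes "fin_model T M"
  shows "iso_class T M = iso_class T N \<longleftrightarrow> isomorphic M N"
proof
  assume "iso_class T M = iso_class T N"
  moreover have "M \<in> iso_class T M" using assms by (simp add: mem_iso_class)
  ultimately show "isomorphic M N" by (simp add: mem_iso_class isomorphic_sym)
next
  assume "isomorphic M N"
  then show "iso_class T M = iso_class T N"
    unfolding iso_class_def using isomorphic_cong_left by blast
qed

section \<open>Densities in hereditary theories\<close>

text \<open>The field \<open>ax\<close> is an arbitrary predicate, so universality is not built into
  the record. Closure under induced submodels is the consequence of universality on which the proof
  rests; finiteness of the language bounds the number of classes of each size.\<close>

definition hereditary :: "'p canon_thy \<Rightarrow> bool" where
  "hereditary T \<longleftrightarrow> finite (syms T) \<and> (\<forall>M W. model T M \<longrightarrow> model T (induced M W))"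

lemma verts_induced [simp]: "verts (induced M W) = verts M \<inter> W"
  by (simp add: induced_def)

lemma fin_model_induced: 
  "hereditary T \<Longrightarrow> model T M \<Longrightarrow> finite W \<Longrightarrow> fin_model T (induced M W)"
  by (auto simp: hereditary_def fin_model_def)

lemma hereditaryI:
  assumes "finite (syms T)" "\<And>M W. ax T M \<Longrightarrow> ax T (induced M W)"
  shows "hereditary T"
  unfolding hereditary_def model_def is_structure_def
  using assms by (auto simp: induced_def)

lemma hereditary_pure: "finite S \<Longrightarrow> hereditary (pure_thy S ar)"
  by (rule hereditaryI) (auto simp: pure_thy_def)

lemma hereditary_hypergraph: "hereditary (hypergraph_thy k)"
proof (rule hereditaryI)
  fix M :: "unit struc" and W
  assume "ax (hypergraph_thy k) M"
  then show "ax (hypergraph_thy k) (induced M W)"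
    unfolding hypergraph_thy_def induced_def using mset_eq_setD by fastforce
qed (simp add: hypergraph_thy_def)

lemma reductL_induced: "reductL (induced M W) = induced (reductL M) W"
  by (simp add: reductL_def induced_def)

lemma reductR_induced: "reductR (induced M W) = induced (reductR M) W"
  by (simp add: reductR_def induced_def)

lemma verts_reduct [simp]: "verts (reductL M) = verts M" "verts (reductR M) = verts M"
  by (simp_all add: reductL_def reductR_def)

lemma rels_reduct [simp]: "rels (reductL M) P = rels M (Inl P)" "rels (reductR M) Q = rels M (Inr Q)"
  by (simp_all add: reductL_def reductR_def)

lemma ball_Plus: "(\<forall>x\<in>A <+> B. Q x) \<longleftrightarrow> (\<forall>a\<in>A. Q (Inl a)) \<and> (\<forall>b\<in>B. Q (Inr b))"
  by auto

lemma model_union_iff: "model (union_thy T T') M \<longleftrightarrow> model T (reductL M) \<and> model T' (reductR M)"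
  by (simp add: model_def is_structure_def union_thy_def ball_Plus split_sum_all) blast

lemma fin_model_union_iff:
  "fin_model (union_thy T T') M \<longleftrightarrow> fin_model T (reductL M) \<and> fin_model T' (reductR M)"
  unfolding fin_model_def model_union_iff by auto

lemma hereditary_union: "hereditary T \<Longrightarrow> hereditary T' \<Longrightarrow> hereditary (union_thy T T')"
  unfolding hereditary_def model_union_iff reductL_induced reductR_induced
  by (auto simp: union_thy_def)

section \<open>Isomorphism classes of a given size and averages over vertex subsets\<close>

definition classes :: "'p canon_thy \<Rightarrow> nat \<Rightarrow> 'p struc set set" where
  "classes T m = iso_class T ` {M. fin_model T M \<and> card (verts M) = m}"

lemma iso_classes_Union: "iso_classes T = (\<Union>m. classes T m)"
  by (auto simp: iso_classes_def classes_def)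

text \<open>A model with m vertices can be copied onto \<open>{..<m}\<close>, where it is coded by a
  subset of the finite set \<open>I\<close> of pairs of a symbol and a tuple of the right
  length.\<close>

lemma finite_classes:
  fixes T :: "'p canon_thy"
  assumes "finite (syms T)"
  shows "finite (classes T m)"
proof -
  define I where "I = (SIGMA P:syms T. {xs. set xs \<subseteq> {..<m} \<and> length xs = arity T P})"
  define g :: "('p \<times> nat list) set \<Rightarrow> 'p struc set" where
    "g R = iso_class T \<lparr>verts = {..<m}, rels = (\<lambda>P. {xs. (P, xs) \<in> R})\<rparr>" for R
  have "finite I" unfolding I_def using assms by (auto intro: finite_lists_length_eq)
  moreover have "classes T m \<subseteq> g ` Pow I"
  proof
    fix C assume "C \<in> classes T m"
    then obtain M where C: "C = iso_class T M" and M: "fin_model T M" "card (verts M) = m"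
      by (auto simp: classes_def)
    then obtain h where h: "bij_betw h (verts M) {..<m}"
      using ex_bij_betw_finite_nat[of "verts M"] by (auto simp: fin_model_def atLeast0LessThan)
    define R where "R = {(P, map h xs) |P xs. xs \<in> rels M P}"
    have str: "length xs = arity T P \<and> set xs \<subseteq> verts M \<and> P \<in> syms T" if "xs \<in> rels M P" for xs P
      using M that unfolding fin_model_def model_def is_structure_def by blast
    have hv: "h ` verts M = {..<m}" "inj_on h (verts M)" using h by (auto simp: bij_betw_def)
    have "R \<subseteq> I" unfolding R_def I_def using str hv by fastforce
    moreover have "is_iso h M \<lparr>verts = {..<m}, rels = (\<lambda>P. {xs. (P, xs) \<in> R})\<rparr>"
      unfolding is_iso_def
    proof (intro conjI allI impI)
      fix P xs assume xs: "set xs \<subseteq> verts M"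
      have "xs = ys" if "ys \<in> rels M P" "map h xs = map h ys" for ys
        using map_inj_on[OF that(2)] hv(2) str[OF that(1)] xs by (meson inj_on_subset le_supI)
      then show "xs \<in> rels M P \<longleftrightarrow>
          map h xs \<in> rels \<lparr>verts = {..<m}, rels = (\<lambda>P. {xs. (P, xs) \<in> R})\<rparr> P"
        by (auto simp: R_def)
    qed (use h in auto)
    ultimately show "C \<in> g ` Pow I"
      unfolding C g_def using M(1) by (intro image_eqI[of _ _ R]) (auto simp: iso_class_eq_iff isomorphic_def)
  qed
  ultimately show ?thesis by (meson finite_Pow_iff finite_imageI finite_subset)
qed

abbreviation sub :: "nat \<Rightarrow> 'p struc \<Rightarrow> nat set set" where
  "sub m N \<equiv> {W. W \<subseteq> verts N \<and> card W = m}"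

lemma fin_model_verts: "fin_model T N \<Longrightarrow> finite (verts N)"
  by (simp add: fin_model_def)

lemma sub_facts:
  assumes "hereditary T" "fin_model T N" "W \<in> sub m N"
  shows "fin_model T (induced N W)" "card (verts (induced N W)) = m" "verts (induced N W) = W"
  using assms fin_model_induced[of T N W] by (auto simp: fin_model_def Int_absorb1 intro: finite_subset)

lemma ind_density_sum:
  assumes "hereditary T" "fin_model T N" 
  shows "ind_density M N = 
    (\<Sum>W\<in>sub (card (verts M)) N. of_bool (isomorphic (induced N W) M)) / real (card (verts N) choose card (verts M))"
proof -
  have "finite (sub (card (verts M)) N)" using assms by (auto simp: fin_model_def)
  moreover have "{W. W \<subseteq> verts N \<and> card W = card (verts M) \<and> isomorphic (induced N W) M}
     = sub (card (verts M)) N \<inter> {W. isomorphic (induced N W) M}" by blast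
  ultimately show ?thesis unfolding ind_density_def by (simp only: sum_of_bool_eq)
qed

lemma ind_density_range:
  assumes "finite (verts N)"
  shows "ind_density M N \<in> {0..1}"
proof -
  have "card {W. W \<subseteq> verts N \<and> card W = card (verts M) \<and> isomorphic (induced N W) M}
     \<le> card {W. W \<subseteq> verts N \<and> card W = card (verts M)}"
    using assms by (intro card_mono) auto
  also have "\<dots> = card (verts N) choose card (verts M)" using n_subsets[OF assms] by simp
  finally show ?thesis unfolding ind_density_def by (auto simp: divide_le_eq_1)
qed

lemma ind_density_cong: 
  assumes "isomorphic M M'" shows "ind_density M N = ind_density M' N"
  unfolding ind_density_def isomorphic_card[OF assms] isomorphic_cong_right[OF assms] ..

text \<open>A statistic of the induced submodels of size m is a linear combination of finitely many
  densities. This carries both the octahedral inequality and the count of odd coboundaries to the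
  limit.\<close>

lemma subset_average_tendsto:
  fixes F :: "'p struc set \<Rightarrow> real" and N :: "nat \<Rightarrow> 'p struc"
  assumes T: "hereditary T" and N: "\<And>n. fin_model T (N n)"
    and lim: "\<And>M. fin_model T M \<Longrightarrow> (\<lambda>n. ind_density M (N n)) \<longlonglongrightarrow> \<phi> (iso_class T M)"
  shows "(\<lambda>n. (\<Sum>W\<in>sub m (N n). F (iso_class T (induced (N n) W))) / real (card (verts (N n)) choose m))
     \<longlonglongrightarrow> (\<Sum>C\<in>classes T m. F C * \<phi> C)"
proof -
  define d where "d C n = (\<Sum>W\<in>sub m (N n). of_bool (iso_class T (induced (N n) W) = C)) / 
     real (card (verts (N n)) choose m)" for C n
  have d: "(\<lambda>n. d C n) \<longlonglongrightarrow> \<phi> C" if "C \<in> classes T m" for C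
  proof -
    from that obtain M where C: "C = iso_class T M" and M: "fin_model T M" "card (verts M) = m"
      by (auto simp: classes_def)
    have "d C n = ind_density M (N n)" for n
      unfolding ind_density_sum[OF T N] d_def M(2)
      by (intro arg_cong2[where f="(/)"] sum.cong refl) 
         (use sub_facts[OF T N] M C in \<open>auto simp: iso_class_eq_iff\<close>)
    then show ?thesis using lim[OF M(1)] C by simp
  qed
  have "(\<Sum>W\<in>sub m (N n). F (iso_class T (induced (N n) W))) / real (card (verts (N n)) choose m)
     = (\<Sum>C\<in>classes T m. F C * d C n)" for n
  proof -
    have fin: "finite (sub m (N n))" using N by (auto simp: fin_model_def)
    have mem: "iso_class T (induced (N n) W) \<in> classes T m" if "W \<in> sub m (N n)" for W
      using sub_facts[OF T N that] by (auto simp: classes_def)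
    have "(\<Sum>C\<in>classes T m. F C * d C n) = (\<Sum>C\<in>classes T m. \<Sum>W\<in>sub m (N n). 
        F C * of_bool (iso_class T (induced (N n) W) = C)) / real (card (verts (N n)) choose m)"
      by (simp add: d_def sum_distrib_left sum_divide_distrib)
    also have "(\<Sum>C\<in>classes T m. \<Sum>W\<in>sub m (N n). 
        F C * of_bool (iso_class T (induced (N n) W) = C)) = (\<Sum>W\<in>sub m (N n). \<Sum>C\<in>classes T m.
        F C * of_bool (iso_class T (induced (N n) W) = C))" by (rule sum.swap)
    also have "\<dots> = (\<Sum>W\<in>sub m (N n). F (iso_class T (induced (N n) W)))"
    proof (rule sum.cong[OF refl])
      fix W assume "W \<in> sub m (N n)"
      note mem[OF this]
      moreover have "finite (classes T m)" using T by (auto simp: hereditary_def intro: finite_classes)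
      ultimately show "(\<Sum>C\<in>classes T m. F C * of_bool (iso_class T (induced (N n) W) = C)) 
          = F (iso_class T (induced (N n) W))"
        by (simp add: of_bool_def if_distrib sum.delta' cong: if_cong)
    qed
    finally show ?thesis by simp
  qed
  moreover have "(\<lambda>n. \<Sum>C\<in>classes T m. F C * d C n) \<longlonglongrightarrow> (\<Sum>C\<in>classes T m. F C * \<phi> C)"
    by (intro tendsto_intros d)
  ultimately show ?thesis by simp
qed

section \<open>Convergent subsequences\<close>

text \<open>Tychonoff for countably many intervals, in the form of sequential compactness, takes the
  place of a diagonal argument.\<close>

lemma convergent_coordinates:
  fixes f :: "nat \<Rightarrow> nat \<Rightarrow> real"
  assumes "\<And>n i. f n i \<in> {0..1}"
  obtains r l where "strict_mono r" "\<And>i. (\<lambda>n. f (r n) i) \<longlonglongrightarrow> l i"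
proof -
  have "compactin (product_topology (\<lambda>_. euclidean) UNIV) (PiE UNIV (\<lambda>_::nat. {0..1::real}))"
    by (subst compactin_PiE) auto
  then have "compact (PiE UNIV (\<lambda>_::nat. {0..1::real}))"
    by (simp add: euclidean_product_topology)
  then have "seq_compact (PiE UNIV (\<lambda>_::nat. {0..1::real}))"
    by (rule compact_imp_seq_compact)
  moreover have "\<forall>n. f n \<in> PiE UNIV (\<lambda>_. {0..1})" using assms by auto
  ultimately obtain l r where "strict_mono r" "(f \<circ> r) \<longlonglongrightarrow> l"
    unfolding seq_compact_def by metis
  moreover from this(2) have "(\<lambda>n. f (r n) i) \<longlonglongrightarrow> l i" for i
    using continuous_on_tendsto_compose[OF continuous_on_product_coordinates[of i]]
    by (simp add: o_def)
  ultimately show thesis by (intro that)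
qed

lemma convergent_subsequence_densities:
  fixes N :: "nat \<Rightarrow> 'p struc"
  assumes T: "hereditary T" and N: "\<And>n. fin_model T (N n)"
  obtains r \<phi> where "strict_mono r" 
    "\<And>M. fin_model T M \<Longrightarrow> (\<lambda>n. ind_density M (N (r n))) \<longlonglongrightarrow> \<phi> (iso_class T M)"
proof -
  have cnt: "countable (iso_classes T)"
    unfolding iso_classes_Union using T 
    by (intro countable_UN) (auto simp: hereditary_def intro: countable_finite finite_classes)
  \<comment> \<open>One representative for each of the countably many classes suffices, since
    densities are invariant under isomorphism.\<close>
  define rp where "rp i = (SOME M. M \<in> from_nat_into (iso_classes T) i)" for i
  obtain r l where r: "strict_mono r" and l: "\<And>i. (\<lambda>n. ind_density (rp i) (N (r n))) \<longlonglongrightarrow> l i"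
    using convergent_coordinates[of "\<lambda>n i. ind_density (rp i) (N n)"] 
      ind_density_range[OF fin_model_verts[OF N]] by blast
  have "(\<lambda>n. ind_density M (N (r n))) \<longlonglongrightarrow> l (to_nat_on (iso_classes T) (iso_class T M))"
    if M: "fin_model T M" for M
  proof -
    let ?i = "to_nat_on (iso_classes T) (iso_class T M)"
    have "from_nat_into (iso_classes T) ?i = iso_class T M"
      using cnt M by (simp add: iso_classes_def)
    moreover have "M \<in> iso_class T M" using M by (simp add: mem_iso_class)
    ultimately have "rp ?i \<in> iso_class T M" unfolding rp_def by (metis someI)
    then have "isomorphic M (rp ?i)" by (simp add: mem_iso_class)
    from ind_density_cong[OF this] show ?thesis using l[of ?i] by simp
  qed
  then show thesis using r by (intro that[of r "\<lambda>C. l (to_nat_on (iso_classes T) C)"])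
qed

lemma hom_plusI:
  assumes T: "hereditary T" and N: "\<And>n. fin_model T (N n)"
    and mono: "strict_mono (\<lambda>n. card (verts (N n)))"
    and lim: "\<And>M. fin_model T M \<Longrightarrow> (\<lambda>n. ind_density M (N n)) \<longlonglongrightarrow> \<phi> (iso_class T M)"
  shows "\<phi> \<in> hom_plus T"
proof -
  have "\<phi> (iso_class T M) \<in> {0..1}" if "fin_model T M" for M
    using Lim_in_closed_set[OF closed_atLeastAtMost _ _ lim[OF that], of 0 1] 
      ind_density_range[OF fin_model_verts[OF N]] by auto
  then show ?thesis
    unfolding hom_plus_def using assms by (auto simp: iso_classes_def)
qed

text \<open>The reducts keep the vertex set, so only classes of the size of \<open>L\<close>
  contribute to the sums in \<open>coupling\<close>, which are therefore finite. The map
  \<open>R\<close> stands for either reduct.\<close>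

lemma classes_filter:
  fixes \<xi> :: "'u struc set \<Rightarrow> real"
  assumes R: "\<And>M. verts (R M) = verts M" "\<And>M M'. isomorphic M M' \<Longrightarrow> isomorphic (R M) (R M')"
    and fin: "finite (syms U)"
  shows "(\<Sum>C | C \<in> iso_classes U \<and> (\<exists>N\<in>C. isomorphic (R N) L). \<xi> C)
     = (\<Sum>C\<in>classes U (card (verts L)). of_bool (\<exists>N\<in>C. isomorphic (R N) L) * \<xi> C)"
proof -
  let ?m = "card (verts L)"
  have eq: "{C. C \<in> iso_classes U \<and> (\<exists>N\<in>C. isomorphic (R N) L)} = 
      {C \<in> classes U ?m. \<exists>N\<in>C. isomorphic (R N) L}"
  proof -
    have "C \<in> classes U ?m" if C: "C \<in> iso_classes U" "N \<in> C" "isomorphic (R N) L" for C N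
    proof -
      from C obtain M where M: "C = iso_class U M" "fin_model U M" by (auto simp: iso_classes_def)
      then have "card (verts M) = ?m"
        using C(2) isomorphic_card[OF C(3)] by (auto simp: mem_iso_class R dest: isomorphic_card)
      then show ?thesis using M by (auto simp: classes_def)
    qed
    moreover have "classes U ?m \<subseteq> iso_classes U" by (auto simp: iso_classes_Union)
    ultimately show ?thesis by auto
  qed
  show ?thesis
    unfolding eq sum.inter_filter[OF finite_classes[OF fin]] by (intro sum.cong refl) (simp add: of_bool_def)
qed

text \<open>Taking reducts commutes with inducing, so a density in the reduct is the average over
  vertex subsets of an indicator that depends only on the class in the larger theory.\<close>

lemma reduct_density_tendsto:
  fixes N :: "nat \<Rightarrow> 'u struc"
  assumes R: "\<And>M. verts (R M) = verts M" "\<And>M M'. isomorphic M M' \<Longrightarrow> isomorphic (R M) (R M')"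
      "\<And>M W. R (induced M W) = induced (R M) W"
    and T: "hereditary T" "\<And>M. fin_model U M \<Longrightarrow> fin_model T (R M)"
    and U: "hereditary U" and N: "\<And>n. fin_model U (N n)"
    and lim: "\<And>M. fin_model U M \<Longrightarrow> (\<lambda>n. ind_density M (N n)) \<longlonglongrightarrow> \<xi> (iso_class U M)"
  shows "(\<lambda>n. ind_density L (R (N n))) \<longlonglongrightarrow> (\<Sum>C | C \<in> iso_classes U \<and> (\<exists>N\<in>C. isomorphic (R N) L). \<xi> C)"
proof -
  let ?m = "card (verts L)"
  define F where "F C = (of_bool (\<exists>N\<in>C. isomorphic (R N) L) :: real)" for C
  have F: "F (iso_class U M) = of_bool (isomorphic (R M) L)" if "fin_model U M" for M
  proof -
    have "(\<exists>N\<in>iso_class U M. isomorphic (R N) L) \<longleftrightarrow> isomorphic (R M) L"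
      using that R(2) isomorphic_refl[of M] isomorphic_trans unfolding mem_iso_class Bex_def by blast
    then show ?thesis by (simp add: F_def)
  qed
  have "ind_density L (R (N n)) = 
      (\<Sum>W\<in>sub ?m (N n). F (iso_class U (induced (N n) W))) / real (card (verts (N n)) choose ?m)" for n
    unfolding ind_density_sum[OF T(1) T(2)[OF N]] R
    by (intro arg_cong2[where f="(/)"] sum.cong refl) (use sub_facts[OF U N] in \<open>simp add: F R\<close>)
  moreover have "(\<Sum>C | C \<in> iso_classes U \<and> (\<exists>N\<in>C. isomorphic (R N) L). \<xi> C) = (\<Sum>C\<in>classes U ?m. F C * \<xi> C)"
    using classes_filter[OF R(1,2)] U unfolding F_def hereditary_def by blast
  ultimately show ?thesis
    using subset_average_tendsto[OF U N lim, where F=F and m="?m"] by simp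
qed

text \<open>Convergence is extracted once, in the joint language; the two reducts then converge
  along the same subsequence, and to the very sums that define a coupling.\<close>

lemma coupling_of_sequence:
  fixes N :: "nat \<Rightarrow> ('p + 'q) struc" and T :: "'p canon_thy" and T' :: "'q canon_thy"
  assumes T: "hereditary T" "hereditary T'" and N: "\<And>n. fin_model (union_thy T T') (N n)"
    and mono: "strict_mono (\<lambda>n. card (verts (N n)))"
  obtains r \<phi> \<psi> \<xi> where "strict_mono r" "\<phi> \<in> hom_plus T" "\<psi> \<in> hom_plus T'" "coupling T T' \<phi> \<psi> \<xi>"
    "\<And>M. fin_model (union_thy T T') M \<Longrightarrow> (\<lambda>n. ind_density M (N (r n))) \<longlonglongrightarrow> \<xi> (iso_class (union_thy T T') M)"
    "\<And>M. fin_model T M \<Longrightarrow> (\<lambda>n. ind_density M (reductL (N (r n)))) \<longlonglongrightarrow> \<phi> (iso_class T M)"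
    "\<And>M. fin_model T' M \<Longrightarrow> (\<lambda>n. ind_density M (reductR (N (r n)))) \<longlonglongrightarrow> \<psi> (iso_class T' M)"
proof -
  let ?U = "union_thy T T'"
  have U: "hereditary ?U" using T by (rule hereditary_union)
  obtain r \<xi> where r: "strict_mono r" 
    and lim: "\<And>M. fin_model ?U M \<Longrightarrow> (\<lambda>n. ind_density M (N (r n))) \<longlonglongrightarrow> \<xi> (iso_class ?U M)"
    by (rule convergent_subsequence_densities[OF U, of N]) (use N in blast)+
  have mono': "strict_mono (\<lambda>n. card (verts (N (r n))))"
    using mono r unfolding strict_mono_def by blast
  have redL: "fin_model T (reductL M)" and redR: "fin_model T' (reductR M)" if "fin_model ?U M" for M
    using that by (simp_all add: fin_model_union_iff)
  \<comment> \<open>The argument is a class rather than a structure, hence membership here; on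
    isomorphism classes it amounts to isomorphism of the reduct.\<close>
  define \<phi> where "\<phi> D = (\<Sum>C | C \<in> iso_classes ?U \<and> (\<exists>N\<in>C. reductL N \<in> D). \<xi> C)" for D
  define \<psi> where "\<psi> D = (\<Sum>C | C \<in> iso_classes ?U \<and> (\<exists>N\<in>C. reductR N \<in> D). \<xi> C)" for D
  have mem: "fin_model ?U N'" if "C \<in> iso_classes ?U" "N' \<in> C" for C N'
    using that by (auto simp: iso_classes_def mem_iso_class)
  have \<phi>: "\<phi> (iso_class T M) = (\<Sum>C | C \<in> iso_classes ?U \<and> (\<exists>N\<in>C. isomorphic (reductL N) M). \<xi> C)" for M
    unfolding \<phi>_def
  proof (rule sum.cong[OF _ refl])
    have "(\<exists>N\<in>C. reductL N \<in> iso_class T M) \<longleftrightarrow> (\<exists>N\<in>C. isomorphic (reductL N) M)" if "C \<in> iso_classes ?U" for C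
      using that by (intro bex_cong refl) (metis mem_iso_class isomorphic_sym redL mem)
    then show "{C \<in> iso_classes ?U. \<exists>N\<in>C. reductL N \<in> iso_class T M} =
        {C \<in> iso_classes ?U. \<exists>N\<in>C. isomorphic (reductL N) M}" by (rule Collect_cong[OF conj_cong[OF refl]])
  qed
  have \<psi>: "\<psi> (iso_class T' M) = (\<Sum>C | C \<in> iso_classes ?U \<and> (\<exists>N\<in>C. isomorphic (reductR N) M). \<xi> C)" for M
    unfolding \<psi>_def
  proof (rule sum.cong[OF _ refl])
    have "(\<exists>N\<in>C. reductR N \<in> iso_class T' M) \<longleftrightarrow> (\<exists>N\<in>C. isomorphic (reductR N) M)" if "C \<in> iso_classes ?U" for C
      using that by (intro bex_cong refl) (metis mem_iso_class isomorphic_sym redR mem)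
    then show "{C \<in> iso_classes ?U. \<exists>N\<in>C. reductR N \<in> iso_class T' M} =
        {C \<in> iso_classes ?U. \<exists>N\<in>C. isomorphic (reductR N) M}" by (rule Collect_cong[OF conj_cong[OF refl]])
  qed
  have limL: "(\<lambda>n. ind_density M (reductL (N (r n)))) \<longlonglongrightarrow> \<phi> (iso_class T M)" for M
    unfolding \<phi> by (rule reduct_density_tendsto[where U="?U" and T=T])
      (simp_all add: isomorphic_reductL reductL_induced T(1) redL U N lim)
  have limR: "(\<lambda>n. ind_density M (reductR (N (r n)))) \<longlonglongrightarrow> \<psi> (iso_class T' M)" for M
    unfolding \<psi> by (rule reduct_density_tendsto[where U="?U" and T=T'])
      (simp_all add: isomorphic_reductR reductR_induced T(2) redR U N lim)
  have "\<phi> \<in> hom_plus T" by (rule hom_plusI[OF T(1) redL[OF N] _ limL]) (simp add: mono')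
  moreover have "\<psi> \<in> hom_plus T'" by (rule hom_plusI[OF T(2) redR[OF N] _ limR]) (simp add: mono')
  moreover have "\<xi> \<in> hom_plus ?U" by (rule hom_plusI[OF U N mono' lim])
  then have "coupling T T' \<phi> \<psi> \<xi>" unfolding coupling_def \<phi> \<psi> by blast
  ultimately show thesis using that r lim limL limR by blast
qed

section \<open>Exchangeable arrays\<close>

interpretation unit_interval: prob_space "restrict_space lborel {0..1::real}"
  by (rule prob_spaceI) (simp add: emeasure_restrict_space space_restrict_space)

interpretation cube: prob_space "cube V"
  unfolding cube_def by (intro prob_space_PiM) unfold_locales

lemma mem_rels_array: 
  "xs \<in> rels (array T \<N> \<theta>) P \<longleftrightarrow> P \<in> syms T \<and> length xs = arity T P \<and> distinct xs \<and>
        (\<lambda>A\<in>nonempty_fin {..<arity T P}. \<theta> ((\<lambda>i. xs ! i) ` A)) \<in> \<N> P"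
  by (simp add: array_def)

lemma pred_rels_array:
  assumes "\<And>P. P \<in> syms T \<Longrightarrow> \<N> P \<in> sets (cube {..<arity T P})"
  shows "Measurable.pred (cube UNIV) (\<lambda>\<theta>. xs \<in> rels (array T \<N> \<theta>) P)"
proof (cases "P \<in> syms T \<and> length xs = arity T P \<and> distinct xs")
  case True
  have [measurable]: "\<N> P \<in> sets (cube {..<arity T P})" using assms True by simp
  have [measurable]: "(\<lambda>\<theta>. \<lambda>A\<in>nonempty_fin {..<arity T P}. \<theta> ((\<lambda>i. xs ! i) ` A)) 
      \<in> measurable (cube UNIV) (cube {..<arity T P})"
    unfolding cube_def
    by (intro measurable_restrict measurable_component_singleton) (auto simp: nonempty_fin_def)
  show ?thesis using True by (simp add: mem_rels_array)
next
  case False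
  then have "\<And>\<theta>. \<not> xs \<in> rels (array T \<N> \<theta>) P" by (auto simp: mem_rels_array)
  then show ?thesis by simp
qed

section \<open>Exchangeability under injective relabelling\<close>

definition relabel :: "(nat \<Rightarrow> nat) \<Rightarrow> (nat set \<Rightarrow> real) \<Rightarrow> nat set \<Rightarrow> real" where
  "relabel \<sigma> \<theta> = (\<lambda>A\<in>nonempty_fin UNIV. \<theta> (\<sigma> ` A))"

text \<open>An injective \<open>\<sigma>\<close> maps distinct index sets to distinct index sets, so
  the new coordinates are again independent and uniform.\<close>

lemma distr_relabel:
  assumes "inj \<sigma>"
  shows "relabel \<sigma> \<in> measurable (cube UNIV) (cube UNIV)" 
    "distr (cube UNIV) (cube UNIV) (relabel \<sigma>) = cube UNIV"
proof -
  have inj: "inj_on ((`) \<sigma>) (nonempty_fin UNIV)" using assms by (simp add: inj_on_def inj_image_eq_iff)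
  have im: "(`) \<sigma> \<in> nonempty_fin UNIV \<rightarrow> nonempty_fin UNIV" by (auto simp: nonempty_fin_def)
  show "relabel \<sigma> \<in> measurable (cube UNIV) (cube UNIV)"
    unfolding cube_def relabel_def
    by (intro measurable_restrict measurable_component_singleton) (auto simp: nonempty_fin_def)
  show "distr (cube UNIV) (cube UNIV) (relabel \<sigma>) = cube UNIV"
    unfolding cube_def relabel_def
    by (rule distr_PiM_reindex[OF _ inj im]) unfold_locales
qed

lemma rels_array_relabel:
  assumes "inj \<sigma>"
  shows "xs \<in> rels (array T \<N> (relabel \<sigma> \<theta>)) P \<longleftrightarrow> map \<sigma> xs \<in> rels (array T \<N> \<theta>) P"
proof (cases "length xs = arity T P")
  case True
  have "relabel \<sigma> \<theta> ((!) xs ` A) = \<theta> ((!) (map \<sigma> xs) ` A)" if "A \<in> nonempty_fin {..<arity T P}" for A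
  proof -
    have "(!) xs ` A \<in> nonempty_fin UNIV" using that by (auto simp: nonempty_fin_def)
    moreover have "\<sigma> ` (!) xs ` A = (!) (map \<sigma> xs) ` A"
      using that True by (force simp: nonempty_fin_def image_image intro!: image_cong)
    ultimately show ?thesis by (simp add: relabel_def)
  qed
  then have "(\<lambda>A\<in>nonempty_fin {..<arity T P}. relabel \<sigma> \<theta> ((!) xs ` A)) =
    (\<lambda>A\<in>nonempty_fin {..<arity T P}. \<theta> ((!) (map \<sigma> xs) ` A))" by (intro restrict_ext)
  then show ?thesis
    using assms by (simp add: mem_rels_array distinct_map inj_on_subset[of _ UNIV])
qed (simp add: mem_rels_array)

lemma expectation_relabel:
  fixes g :: "(nat set \<Rightarrow> real) \<Rightarrow> real"
  assumes "inj \<sigma>" "g \<in> borel_measurable (cube UNIV)"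
  shows "cube.expectation UNIV (\<lambda>\<theta>. g (relabel \<sigma> \<theta>)) = cube.expectation UNIV g"
  using integral_distr[OF distr_relabel(1)[OF assms(1)] assms(2)] 
  by (simp add: distr_relabel(2)[OF assms(1)])

text \<open>Structures carry the discrete sigma-algebra. The induced structure is measurable for it
  because it takes finitely many values, being a function of the set \<open>R \<theta>\<close> of
  those pairs in the finite set \<open>I\<close> that hold.\<close>

lemma measurable_induced_array:
  fixes T :: "'p canon_thy"
  assumes N: "\<And>P. P \<in> syms T \<Longrightarrow> \<N> P \<in> sets (cube {..<arity T P})" and fin: "finite (syms T)"
  shows "(\<lambda>\<theta>. induced (array T \<N> \<theta>) {..<m}) \<in> measurable (cube UNIV) (count_space UNIV)"
proof -
  define I where "I = (SIGMA P:syms T. {xs. set xs \<subseteq> {..<m} \<and> length xs = arity T P})"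
  have I: "finite I" unfolding I_def using fin by (auto intro: finite_lists_length_eq)
  define R where "R \<theta> = {i \<in> I. snd i \<in> rels (array T \<N> \<theta>) (fst i)}" for \<theta>
  have "R \<in> measurable (cube UNIV) (count_space (Pow I))"
  proof (subst measurable_count_space_eq2)
    show "finite (Pow I)" using I by simp
    have "R -` {a} \<inter> space (cube UNIV) \<in> sets (cube UNIV)" if "a \<subseteq> I" for a
    proof -
      note [measurable] = pred_rels_array[OF N] and [measurable] = I
      have "R -` {a} \<inter> space (cube UNIV) = {\<theta> \<in> space (cube UNIV). 
          \<forall>i\<in>I. (i \<in> a) = (snd i \<in> rels (array T \<N> \<theta>) (fst i))}"
      proof -
        have "R \<theta> = a \<longleftrightarrow> (\<forall>i\<in>I. (i \<in> a) = (snd i \<in> rels (array T \<N> \<theta>) (fst i)))" for \<theta>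
          unfolding R_def using that by blast
        then show ?thesis by (simp add: vimage_def Int_def conj_commute)
      qed
      also have "\<dots> \<in> sets (cube UNIV)"
        by (rule sets.sets_Collect_finite_All[OF _ I]) measurable
      finally show ?thesis .
    qed
    then show "R \<in> space (cube UNIV) \<rightarrow> Pow I \<and> (\<forall>a\<in>Pow I. R -` {a} \<inter> space (cube UNIV) \<in> sets (cube UNIV))"
      by (auto simp: R_def)
  qed
  then have R: "R \<in> measurable (cube UNIV) (count_space UNIV)"
    by (rule measurable_compose[where g=id, simplified id_o, unfolded id_def]) simp
  have "induced (array T \<N> \<theta>) {..<m} = (\<lambda>R. \<lparr>verts = {..<m}, rels = (\<lambda>P. {xs. (P, xs) \<in> R})\<rparr>) (R \<theta>)" for \<theta>
    by (auto simp: induced_def R_def I_def mem_rels_array) (simp_all add: array_def)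
  then show ?thesis using measurable_compose[OF R, where L="count_space UNIV"] by simp
qed

lemma represents_measurable:
  "represents T \<N> \<xi> \<Longrightarrow> P \<in> syms T \<Longrightarrow> \<N> P \<in> sets (cube {..<arity T P})"
  by (simp add: represents_def)

text \<open>Almost surely the first m vertices span a model, so exactly one class of size m occurs,
  and \<open>represents\<close> gives its probability.\<close>

lemma expectation_iso_class:
  fixes F :: "'p struc set \<Rightarrow> real"
  assumes T: "hereditary T" and rep: "represents T \<N> \<xi>"
  shows "cube.expectation UNIV (\<lambda>\<theta>. F (iso_class T (induced (array T \<N> \<theta>) {..<m}))) = 
    (\<Sum>C\<in>classes T m. F C * \<xi> C)"
proof -
  let ?K = "\<lambda>\<theta>. induced (array T \<N> \<theta>) {..<m}"
  have fin: "finite (classes T m)" using T by (simp add: hereditary_def finite_classes)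
  have K[measurable]: "?K \<in> measurable (cube UNIV) (count_space UNIV)"
    using measurable_induced_array represents_measurable[OF rep] T by (auto simp: hereditary_def)
  have "AE \<theta> in cube UNIV. model T (array T \<N> \<theta>)" using rep by (simp add: represents_def)
  then have "AE \<theta> in cube UNIV. F (iso_class T (?K \<theta>)) = 
     (\<Sum>C\<in>classes T m. F C * of_bool (iso_class T (?K \<theta>) = C))"
  proof eventually_elim
    case (elim \<theta>)
    then have "fin_model T (?K \<theta>)" using fin_model_induced[OF T] by auto
    moreover have "card (verts (?K \<theta>)) = m" by (simp add: array_def)
    ultimately have "iso_class T (?K \<theta>) \<in> classes T m" by (auto simp: classes_def)
    then show ?case using fin by (simp add: of_bool_def if_distrib sum.delta' cong: if_cong)
  qed
  then have "cube.expectation UNIV (\<lambda>\<theta>. F (iso_class T (?K \<theta>))) = 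
    cube.expectation UNIV (\<lambda>\<theta>. \<Sum>C\<in>classes T m. F C * of_bool (iso_class T (?K \<theta>) = C))"
    by (intro integral_cong_AE measurable_compose[OF K]) auto
  also have "\<dots> = (\<Sum>C\<in>classes T m. F C * cube.expectation UNIV (\<lambda>\<theta>. of_bool (iso_class T (?K \<theta>) = C)))"
    by (subst Bochner_Integration.integral_sum)
       (auto intro!: integrable_mult_right cube.integrable_const_bound[where B=1] measurable_compose[OF K])
  also have "\<dots> = (\<Sum>C\<in>classes T m. F C * \<xi> C)"
  proof (intro sum.cong arg_cong2[where f="(*)"] refl)
    fix C assume C: "C \<in> classes T m"
    obtain M where M: "C = iso_class T M" "fin_model T M" "card (verts M) = m" 
      using C by (auto simp: classes_def)
    have "(\<lambda>\<theta>. of_bool (iso_class T (?K \<theta>) = C)) = (\<lambda>\<theta>. indicat_real {\<theta>. isomorphic (?K \<theta>) M} \<theta>)"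
      using iso_class_eq_iff[OF M(2)] isomorphic_sym by (auto simp: M(1) indicator_def of_bool_def fun_eq_iff)
    moreover have "cube.expectation UNIV (indicat_real {\<theta>. isomorphic (?K \<theta>) M}) = 
      cube.prob UNIV {\<theta> \<in> space (cube UNIV). isomorphic (?K \<theta>) M}"
      by (simp add: Int_def conj_commute)
    ultimately show "cube.expectation UNIV (\<lambda>\<theta>. of_bool (iso_class T (?K \<theta>) = C)) = \<xi> C" 
      using rep M unfolding represents_def by simp
  qed
  finally show ?thesis .
qed

text \<open>The right side mentions neither \<open>\<xi>\<close> nor \<open>\<N>\<close>. Hence a
  statistic of the hypergraph alone can be evaluated from \<open>\<phi>\<close> whatever coupling
  Dev supplies.\<close>

lemma expectation_reductL:
  fixes F :: "'p struc set \<Rightarrow> real" and T' :: "'q canon_thy"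
  assumes T: "hereditary T" "hereditary T'" and coup: "coupling T T' \<phi> \<psi> \<xi>" 
    and rep: "represents (union_thy T T') \<N> \<xi>"
  shows "cube.expectation UNIV (\<lambda>\<theta>. F (iso_class T (reductL (induced (array (union_thy T T') \<N> \<theta>) {..<m})))) = 
    (\<Sum>C\<in>classes T m. F C * \<phi> C)"
proof -
  let ?U = "union_thy T T'"
  \<comment> \<open>The map on classes induced by the reduct, computed on a chosen member; grouping
    the classes of the union by it turns \<open>\<xi>\<close> into \<open>\<phi>\<close>.\<close>
  let ?r = "\<lambda>C. iso_class T (reductL (SOME M. M \<in> C))"
  have U: "hereditary ?U" using T by (rule hereditary_union)
  have fin: "finite (classes T m)" "finite (classes ?U m)" 
    using T U by (simp_all add: hereditary_def finite_classes)
  have r: "?r (iso_class ?U M) = iso_class T (reductL M)" if "fin_model ?U M" for M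
  proof -
    have "(SOME M'. M' \<in> iso_class ?U M) \<in> iso_class ?U M"
      using that by (intro someI[of "\<lambda>M'. M' \<in> iso_class ?U M" M]) (simp add: mem_iso_class)
    then have "isomorphic M (SOME M'. M' \<in> iso_class ?U M)" by (simp add: mem_iso_class)
    then show ?thesis using that
      by (metis isomorphic_reductL iso_class_eq_iff fin_model_union_iff)
  qed
  have K[measurable]: "(\<lambda>\<theta>. induced (array ?U \<N> \<theta>) {..<m}) \<in> measurable (cube UNIV) (count_space UNIV)"
    using measurable_induced_array represents_measurable[OF rep] U by (auto simp: hereditary_def)
  have \<phi>: "\<phi> D = (\<Sum>C\<in>classes ?U m. of_bool (?r C = D) * \<xi> C)" if D: "D \<in> classes T m" for D
  proof -
    obtain M where M: "D = iso_class T M" "fin_model T M" "card (verts M) = m" 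
      using D by (auto simp: classes_def)
    have "\<phi> D = (\<Sum>C\<in>classes ?U m. of_bool (\<exists>N\<in>C. isomorphic (reductL N) M) * \<xi> C)"
      using coup M classes_filter[where R=reductL and U="?U" and L=M and \<xi>=\<xi>] U
      by (simp add: coupling_def isomorphic_reductL hereditary_def)
    also have "\<dots> = (\<Sum>C\<in>classes ?U m. of_bool (?r C = D) * \<xi> C)"
    proof (rule sum.cong[OF refl])
      fix C assume "C \<in> classes ?U m"
      then obtain L where L: "C = iso_class ?U L" "fin_model ?U L" by (auto simp: classes_def)
      have "(\<exists>N\<in>C. isomorphic (reductL N) M) \<longleftrightarrow> isomorphic (reductL L) M"
        using L isomorphic_refl isomorphic_trans isomorphic_reductL by (auto simp: mem_iso_class) blast
      also have "\<dots> \<longleftrightarrow> ?r C = D" 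
        using iso_class_eq_iff[OF M(2), of "reductL L"] isomorphic_sym r[OF L(2)] 
        unfolding M(1) L(1) by metis
      finally show "of_bool (\<exists>N\<in>C. isomorphic (reductL N) M) * \<xi> C = of_bool (?r C = D) * \<xi> C" by simp
    qed
    finally show ?thesis .
  qed
  have "AE \<theta> in cube UNIV. model ?U (array ?U \<N> \<theta>)" using rep by (simp add: represents_def)
  then have "AE \<theta> in cube UNIV. F (iso_class T (reductL (induced (array ?U \<N> \<theta>) {..<m}))) = 
     F (?r (iso_class ?U (induced (array ?U \<N> \<theta>) {..<m})))"
    by eventually_elim (simp add: r fin_model_induced[OF U])
  then have "cube.expectation UNIV (\<lambda>\<theta>. F (iso_class T (reductL (induced (array ?U \<N> \<theta>) {..<m})))) = 
    cube.expectation UNIV (\<lambda>\<theta>. (F \<circ> ?r) (iso_class ?U (induced (array ?U \<N> \<theta>) {..<m})))"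
    by (intro integral_cong_AE measurable_compose[OF K]) auto
  also have "\<dots> = (\<Sum>C\<in>classes ?U m. F (?r C) * \<xi> C)"
    unfolding expectation_iso_class[OF U rep] by simp
  also have "\<dots> = (\<Sum>C\<in>classes ?U m. \<Sum>D\<in>classes T m. F D * (of_bool (?r C = D) * \<xi> C))"
  proof (rule sum.cong[OF refl])
    fix C assume "C \<in> classes ?U m"
    then obtain L where L: "C = iso_class ?U L" "fin_model ?U L" "card (verts L) = m" by (auto simp: classes_def)
    then have "?r C \<in> classes T m" using r by (auto simp: classes_def fin_model_union_iff)
    then show "F (?r C) * \<xi> C = (\<Sum>D\<in>classes T m. F D * (of_bool (?r C = D) * \<xi> C))"
      using fin by (simp add: of_bool_def if_distrib if_distribR sum.delta' cong: if_cong)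
  qed
  also have "\<dots> = (\<Sum>D\<in>classes T m. F D * \<phi> D)"
    by (subst sum.swap) (simp add: \<phi> sum_distrib_left)
  finally show ?thesis .
qed

section \<open>Doubling vertices\<close>

text \<open>Expanding the mean square of the sum of n of the \<open>X i\<close> minus
  \<open>n * a * H\<close>, which is nonnegative, gives n (a^2 - b) \<le> 1 - b for every n > 0. In
  the application \<open>H\<close> collects factors that do not see a vertex, and the
  \<open>X i\<close> place different vertices there.\<close>

lemma (in prob_space) exchangeable_Cauchy_Schwarz:
  fixes X :: "nat \<Rightarrow> 'a \<Rightarrow> real"
  assumes [measurable]: "H \<in> borel_measurable M" "\<And>i. X i \<in> borel_measurable M"
    and bd: "\<And>\<omega>. \<bar>H \<omega>\<bar> \<le> 1" "\<And>i \<omega>. \<bar>X i \<omega>\<bar> \<le> 1"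
    and a: "\<And>i. expectation (\<lambda>\<omega>. H \<omega> * X i \<omega>) = a"
    and b: "\<And>i j. i \<noteq> j \<Longrightarrow> expectation (\<lambda>\<omega>. X i \<omega> * X j \<omega>) = b"
  shows "a\<^sup>2 \<le> b"
proof -
  have prod_bd: "\<bar>x * y\<bar> \<le> 1" if "\<bar>x\<bar> \<le> 1" "\<bar>y\<bar> \<le> 1" for x y :: real
    using mult_mono[OF that] by (simp add: abs_mult)
  have int[simp]: "integrable M (\<lambda>\<omega>. X i \<omega> * X j \<omega>)" "integrable M (\<lambda>\<omega>. H \<omega> * X i \<omega>)" 
      "integrable M (\<lambda>\<omega>. H \<omega> * H \<omega>)" for i j
  proof -
    have "integrable M (\<lambda>\<omega>. g \<omega> * h \<omega>)" if [measurable]: "g \<in> borel_measurable M" "h \<in> borel_measurable M"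
      and "\<And>\<omega>. \<bar>g \<omega>\<bar> \<le> 1" "\<And>\<omega>. \<bar>h \<omega>\<bar> \<le> 1" for g h :: "'a \<Rightarrow> real"
    proof (rule integrable_const_bound[where B=1])
      show "AE \<omega> in M. norm (g \<omega> * h \<omega>) \<le> 1"
        unfolding real_norm_def by (intro AE_I2 prod_bd that(3,4))
    qed measurable
    then show "integrable M (\<lambda>\<omega>. X i \<omega> * X j \<omega>)" "integrable M (\<lambda>\<omega>. H \<omega> * X i \<omega>)" 
      "integrable M (\<lambda>\<omega>. H \<omega> * H \<omega>)" using assms(1,2) bd by blast+
  qed
  have le1: "expectation (\<lambda>\<omega>. X i \<omega> * X i \<omega>) \<le> 1" "expectation (\<lambda>\<omega>. H \<omega> * H \<omega>) \<le> 1" for i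
  proof -
    have "X i \<omega> * X i \<omega> \<le> 1" "H \<omega> * H \<omega> \<le> 1" for \<omega>
      using prod_bd[OF bd(2)[of i \<omega>] bd(2)[of i \<omega>]] prod_bd[OF bd(1)[of \<omega>] bd(1)[of \<omega>]] by linarith+
    note le = this
    show "expectation (\<lambda>\<omega>. X i \<omega> * X i \<omega>) \<le> 1"
      by (intro integral_le_const AE_I2 int le)
    show "expectation (\<lambda>\<omega>. H \<omega> * H \<omega>) \<le> 1"
      by (intro integral_le_const AE_I2 int le)
  qed
  have main: "real n * (a\<^sup>2 - b) \<le> 1 - b" if n: "n > 0" for n
  proof -
    \<comment> \<open>\<open>?c\<close> is the mean of \<open>H * ?S\<close>. The diagonal of the
      square of \<open>?S\<close> contributes at most n, against a main term of order n^2.\<close>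
    let ?S = "\<lambda>\<omega>. \<Sum>i<n. X i \<omega>" and ?c = "real n * a"
    have "0 \<le> expectation (\<lambda>\<omega>. (?S \<omega> - ?c * H \<omega>)\<^sup>2)"
      by (rule Bochner_Integration.integral_nonneg) simp
    also have "(\<lambda>\<omega>. (?S \<omega> - ?c * H \<omega>)\<^sup>2) = (\<lambda>\<omega>. (\<Sum>i<n. \<Sum>j<n. X i \<omega> * X j \<omega>) 
        - 2 * ?c * (\<Sum>i<n. H \<omega> * X i \<omega>) + ?c\<^sup>2 * (H \<omega> * H \<omega>))"
      by (simp only: sum_product[symmetric], simp only: sum_distrib_left[symmetric])
         (simp add: power2_eq_square algebra_simps fun_eq_iff)
    also have "expectation \<dots> = (\<Sum>i<n. \<Sum>j<n. expectation (\<lambda>\<omega>. X i \<omega> * X j \<omega>)) 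
        - 2 * ?c * (\<Sum>i<n. expectation (\<lambda>\<omega>. H \<omega> * X i \<omega>)) + ?c\<^sup>2 * expectation (\<lambda>\<omega>. H \<omega> * H \<omega>)"
      by simp
    also have "(\<Sum>i<n. expectation (\<lambda>\<omega>. H \<omega> * X i \<omega>)) = ?c" by (simp add: a)
    also have "(\<Sum>i<n. \<Sum>j<n. expectation (\<lambda>\<omega>. X i \<omega> * X j \<omega>)) \<le> (\<Sum>i<n. 1 + real (n - 1) * b)"
    proof (rule sum_mono)
      fix i assume i: "i \<in> {..<n}"
      have "(\<Sum>j<n. expectation (\<lambda>\<omega>. X i \<omega> * X j \<omega>)) = expectation (\<lambda>\<omega>. X i \<omega> * X i \<omega>) + 
         (\<Sum>j\<in>{..<n} - {i}. expectation (\<lambda>\<omega>. X i \<omega> * X j \<omega>))" 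
        using i by (subst sum.remove[of _ i]) auto
      also have "(\<Sum>j\<in>{..<n} - {i}. expectation (\<lambda>\<omega>. X i \<omega> * X j \<omega>)) = (\<Sum>j\<in>{..<n} - {i}. b)"
        by (intro sum.cong refl b) auto
      finally show "(\<Sum>j<n. expectation (\<lambda>\<omega>. X i \<omega> * X j \<omega>)) \<le> 1 + real (n - 1) * b"
        using le1(1)[of i] i by simp
    qed
    also have "?c\<^sup>2 * expectation (\<lambda>\<omega>. H \<omega> * H \<omega>) \<le> ?c\<^sup>2"
      using mult_left_mono[OF le1(2), of "?c\<^sup>2"] by simp
    finally have "0 \<le> real n * (1 + real (n - 1) * b) - 2 * ?c * ?c + ?c\<^sup>2" 
      using n by (simp add: of_nat_diff Suc_leI)
    also have "\<dots> = real n * (1 - b - real n * (a\<^sup>2 - b))"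
      using n by (simp add: of_nat_diff power2_eq_square algebra_simps)
    finally show ?thesis using n by (simp add: zero_le_mult_iff)
  qed
  show ?thesis
  proof (rule ccontr)
    assume "\<not> ?thesis"
    then have "0 < a\<^sup>2 - b" by simp
    then obtain n where n: "1 - b < real n * (a\<^sup>2 - b)"
      by (metis reals_Archimedean3)
    have "1 - b < real (Suc n) * (a\<^sup>2 - b)" using n \<open>0 < a\<^sup>2 - b\<close> by (simp add: algebra_simps)
    then show False using main[of "Suc n"] by simp
  qed
qed

text \<open>Here \<open>x\<close> says which vertex of the array plays each role in the edge,
  \<open>s\<close> will be the edge sign, and \<open>Q j\<close> the predicate of the set that omits
  role j; \<open>Q_upd\<close> expresses this omission.\<close>

locale doubling = prob_space M for M :: "'a measure" +
  fixes k :: nat and s :: "(nat \<Rightarrow> nat) \<Rightarrow> 'a \<Rightarrow> real" and Q :: "nat \<Rightarrow> (nat \<Rightarrow> nat) \<Rightarrow> 'a \<Rightarrow> real"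
  assumes s_meas [measurable]: "\<And>x. s x \<in> borel_measurable M" 
    and Q_meas [measurable]: "\<And>j x. Q j x \<in> borel_measurable M"
    and s_bd: "\<And>x \<omega>. \<bar>s x \<omega>\<bar> \<le> 1" and Q_bd: "\<And>j x \<omega>. \<bar>Q j x \<omega>\<bar> \<le> 1"
    and Q_upd: "\<And>j x y. Q j (x(j := y)) = Q j x"
begin

text \<open>What remains after \<open>Q 1\<close>, ..., \<open>Q t\<close> are eliminated: all
  predicates for t = 0, the bare sign for t = k - 1.\<close>

definition f :: "nat \<Rightarrow> (nat \<Rightarrow> nat) \<Rightarrow> 'a \<Rightarrow> real" where
  "f t x \<omega> = s x \<omega> * (\<Prod>j\<in>{t<..<k}. Q j x \<omega>)"

text \<open>The two copies of the vertex \<open>i\<close> are \<open>\<sigma> (2 * i)\<close> and \<open>\<sigma> (2 * i + 1)\<close>.\<close>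

definition corner :: "(nat \<Rightarrow> nat) \<Rightarrow> nat set \<Rightarrow> nat \<Rightarrow> nat" where
  "corner \<sigma> e = (\<lambda>i. \<sigma> (2 * i + of_bool (i \<in> e)))"

text \<open>Roles 1 to t are doubled and \<open>e\<close> lists those that use the second copy; role
  0 and the roles beyond t stay at the first copy.\<close>

definition W :: "nat \<Rightarrow> (nat \<Rightarrow> nat) \<Rightarrow> 'a \<Rightarrow> real" where
  "W t \<sigma> \<omega> = (\<Prod>e\<in>Pow {1..t}. f t (corner \<sigma> e) \<omega>)"

lemma prod_abs_le_1: "(\<And>i. i \<in> I \<Longrightarrow> \<bar>g i :: real\<bar> \<le> 1) \<Longrightarrow> \<bar>\<Prod>i\<in>I. g i\<bar> \<le> 1"
  unfolding abs_prod by (rule prod_le_1) auto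

lemma f_bd: "\<bar>f t x \<omega>\<bar> \<le> 1"
  unfolding f_def abs_mult using prod_abs_le_1[of "{t<..<k}" "\<lambda>j. Q j x \<omega>"] Q_bd s_bd
  by (intro mult_le_one) auto

lemma f_meas [measurable]: "f t x \<in> borel_measurable M"
  unfolding f_def by measurable

lemma f_step: "Suc t < k \<Longrightarrow> f t x \<omega> = Q (Suc t) x \<omega> * f (Suc t) x \<omega>"
proof -
  assume "Suc t < k"
  then have "{t<..<k} = insert (Suc t) {Suc t<..<k}" by auto
  then show ?thesis by (simp add: f_def)
qed

text \<open>One Cauchy--Schwarz step eliminates \<open>Q (Suc t)\<close> at all corners at once:
  these factors ignore role \<open>Suc t\<close>, and the product of two placements of that role is
  the next \<open>W\<close>.\<close>

lemma expectation_W_step: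
  assumes t: "Suc t < k"
    and exch: "\<And>t \<sigma>. t < k \<Longrightarrow> inj \<sigma> \<Longrightarrow> expectation (W t \<sigma>) = expectation (W t id)"
  shows "(expectation (W t id))\<^sup>2 \<le> expectation (W (Suc t) id)"
proof (rule exchangeable_Cauchy_Schwarz)
  let ?t = "Suc t"
  \<comment> \<open>Residues modulo 3 keep the infinitely many placements of role \<open>?t\<close>
    apart from each other and from the vertices of all other roles.\<close>
  define z where "z e y = (corner (\<lambda>n. 3 * n) e)(?t := 3 * y + 1)" for e and y :: nat
  have three: "3 * n \<noteq> Suc (3 * m)" for n m :: nat by presburger
  define X where "X y \<omega> = (\<Prod>e\<in>Pow {1..t}. f ?t (z e y) \<omega>)" for y \<omega>
  define H where "H \<omega> = (\<Prod>e\<in>Pow {1..t}. Q ?t (z e 0) \<omega>)" for \<omega>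
  show "H \<in> borel_measurable M" unfolding H_def by measurable
  show "X y \<in> borel_measurable M" for y unfolding X_def by measurable
  show "\<bar>H \<omega>\<bar> \<le> 1" for \<omega> unfolding H_def by (rule prod_abs_le_1) (rule Q_bd)
  show "\<bar>X y \<omega>\<bar> \<le> 1" for y \<omega> unfolding X_def by (rule prod_abs_le_1) (rule f_bd)
  show "expectation (\<lambda>\<omega>. H \<omega> * X y \<omega>) = expectation (W t id)" for y
  proof -
    define \<sigma> where "\<sigma> n = (if n = 2 * ?t then 3 * y + 1 else 3 * n)" for n
    have inj: "inj \<sigma>" 
      using three by (intro injI) (auto simp: \<sigma>_def dest: sym split: if_split_asm)
    have c: "corner \<sigma> e = z e y" if "e \<in> Pow {1..t}" for e
      unfolding corner_def z_def \<sigma>_def using that by (auto simp: fun_eq_iff)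
    \<comment> \<open>This makes the common factor \<open>H\<close> independent of
      \<open>y\<close>.\<close>
    have Q: "Q ?t (z e y) = Q ?t (z e 0)" for e unfolding z_def Q_upd ..
    have "W t \<sigma> = (\<lambda>\<omega>. H \<omega> * X y \<omega>)"
      unfolding W_def H_def X_def prod.distrib[symmetric] fun_eq_iff
      using Q c by (intro allI prod.cong refl) (simp only: f_step[OF t])
    then show ?thesis using exch[of t \<sigma>] t inj by simp
  qed
  show "expectation (\<lambda>\<omega>. X y \<omega> * X y' \<omega>) = expectation (W ?t id)" if "y \<noteq> y'" for y y'
  proof -
    \<comment> \<open>The two slots of role \<open>?t\<close> receive the two placements; splitting
      the corners by whether \<open>?t\<close> is in \<open>e\<close> then separates
      \<open>X y\<close> from \<open>X y'\<close>.\<close>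
    define \<sigma> where "\<sigma> n = (if n = 2 * ?t then 3 * y + 1 else if n = 2 * ?t + 1 then 3 * y' + 1 else 3 * n)" for n
    have inj: "inj \<sigma>" 
      using that three by (intro injI) (auto simp: \<sigma>_def dest: sym split: if_split_asm)
    have c: "corner \<sigma> e = z e y" "corner \<sigma> (insert ?t e) = z e y'" if "e \<in> Pow {1..t}" for e
      unfolding corner_def z_def \<sigma>_def using that by (auto simp: fun_eq_iff)
    have "W ?t \<sigma> \<omega> = X y \<omega> * X y' \<omega>" for \<omega>
    proof -
      have "Pow {1..?t} = Pow {1..t} \<union> insert ?t ` Pow {1..t}"
        by (simp add: atLeastAtMostSuc_conv Pow_insert)
      moreover have "inj_on (insert ?t) (Pow {1..t})"
      proof (rule inj_onI)
        fix A B assume AB: "A \<in> Pow {1..t}" "B \<in> Pow {1..t}" "insert ?t A = insert ?t B"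
        have "?t \<notin> A" "?t \<notin> B" using AB by auto
        then show "A = B" using AB(3) by (simp add: insert_ident)
      qed
      moreover have disj: "Pow {1..t} \<inter> insert ?t ` Pow {1..t} = {}" by auto
      ultimately have "W ?t \<sigma> \<omega> = (\<Prod>e\<in>Pow {1..t}. f ?t (corner \<sigma> e) \<omega>) * 
           (\<Prod>e\<in>Pow {1..t}. f ?t (corner \<sigma> (insert ?t e)) \<omega>)"
        unfolding W_def by (simp only: prod.union_disjoint[OF finite_Pow_iff[THEN iffD2, OF finite_atLeastAtMost]
            finite_imageI[OF finite_Pow_iff[THEN iffD2, OF finite_atLeastAtMost]] disj] prod.reindex o_def)
      then show ?thesis unfolding X_def by (simp add: c)
    qed
    then have "(\<lambda>\<omega>. X y \<omega> * X y' \<omega>) = W ?t \<sigma>" by (simp add: fun_eq_iff)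
    then show ?thesis using exch[of ?t \<sigma>] t inj by simp
  qed
qed

text \<open>Going down from t = k - 1, a square bounded by a nonpositive number vanishes, so the
  sign condition at the top forces zero at every lower level.\<close>

lemma expectation_eq_0:
  assumes k: "k \<ge> 2"
    and exch: "\<And>t \<sigma>. t < k \<Longrightarrow> inj \<sigma> \<Longrightarrow> expectation (W t \<sigma>) = expectation (W t id)"
    and oct: "expectation (W (k - 1) id) \<le> 0"
  shows "expectation (f 0 (\<lambda>i. 2 * i)) = 0"
proof -
  have "t \<le> k - 1 \<Longrightarrow> expectation (W t id) \<le> 0" for t
  proof (induction rule: inc_induct)
    case (step t)
    then have "(expectation (W t id))\<^sup>2 \<le> expectation (W (Suc t) id)"
      by (intro expectation_W_step exch) auto
    then have "(expectation (W t id))\<^sup>2 \<le> 0" using step.IH by linarith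
    then have "expectation (W t id) = 0" by simp
    then show ?case by (rule eq_refl)
  qed (rule oct)
  \<comment> \<open>The index 1 is in range since k \<ge> 2. The last step, from 1 to 0, yields
    equality, and for t = 0 the single corner puts role i at vertex 2i.\<close>
  from this[of 1] have "expectation (W (Suc 0) id) \<le> 0" using k by simp
  moreover have "(expectation (W 0 id))\<^sup>2 \<le> expectation (W (Suc 0) id)"
    using k by (intro expectation_W_step exch) auto
  ultimately have "expectation (W 0 id) = 0" by (metis order_trans power2_less_eq_zero_iff)
  then show ?thesis by (simp add: W_def corner_def cong: Bochner_Integration.integral_cong)
qed

end

section \<open>An octahedral criterion for Dev\<close>

definition edge_sign :: "unit struc \<Rightarrow> nat list \<Rightarrow> real" where
  "edge_sign G xs = (if xs \<in> rels G () then -1 else 1)"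

text \<open>The positions 2i and 2i + 1 of \<open>ys\<close> hold the two copies of role i, as in
  \<open>corner\<close>. Summing over all orderings makes the value an invariant of the isomorphism
  class.\<close>

definition octahedron_sum :: "nat \<Rightarrow> unit struc \<Rightarrow> real" where
  "octahedron_sum k G = (\<Sum>ys\<in>permutations_of_set (verts G). 
     \<Prod>e\<in>Pow {1..k - 1}. edge_sign G (map (\<lambda>i. ys ! (2 * i + of_bool (i \<in> e))) [0..<k]))"

lemma octahedron_index: "i < k \<Longrightarrow> 2 * i + of_bool b < 2 * (k::nat)"
  by (cases b) auto

lemma octahedron_sum_cong:
  assumes iso: "isomorphic G G'" and card: "card (verts G) = 2 * k"
  shows "octahedron_sum k G = octahedron_sum k G'"
proof -
  from iso obtain f where f: "bij_betw f (verts G) (verts G')"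
    and r: "\<And>xs. set xs \<subseteq> verts G \<Longrightarrow> (xs \<in> rels G () \<longleftrightarrow> map f xs \<in> rels G' ())"
    unfolding isomorphic_def is_iso_def by auto
  have V: "verts G' = f ` verts G" and inj: "inj_on f (verts G)" using f by (auto simp: bij_betw_def)
  have "inj_on (map f) (permutations_of_set (verts G))"
    using inj by (intro inj_onI) (metis map_inj_on permutations_of_setD(1) sup.idem)
  then have "octahedron_sum k G' = (\<Sum>ys\<in>permutations_of_set (verts G). 
     \<Prod>e\<in>Pow {1..k - 1}. edge_sign G' (map (\<lambda>i. map f ys ! (2 * i + of_bool (i \<in> e))) [0..<k]))"
    unfolding octahedron_sum_def V permutations_of_set_image_inj[OF inj] 
    by (simp only: sum.reindex o_def)
  also have "\<dots> = octahedron_sum k G"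
    unfolding octahedron_sum_def
  proof (intro sum.cong prod.cong refl)
    fix ys e assume ys: "ys \<in> permutations_of_set (verts G)"
    have len: "length ys = 2 * k" using ys card by (simp add: length_finite_permutations_of_set)
    let ?xs = "map (\<lambda>i. ys ! (2 * i + of_bool (i \<in> e))) [0..<k]"
    have eq: "map (\<lambda>i. map f ys ! (2 * i + of_bool (i \<in> e))) [0..<k] = map f ?xs"
      using len octahedron_index by auto
    have "set ?xs \<subseteq> verts G" 
      using len octahedron_index permutations_of_setD(1)[OF ys] nth_mem[of _ ys] by force
    from r[OF this] show "edge_sign G' (map (\<lambda>i. map f ys ! (2 * i + of_bool (i \<in> e))) [0..<k]) = edge_sign G ?xs"
      unfolding edge_sign_def eq by (simp only:)
  qed
  finally show ?thesis by simp
qed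

lemma fin_model_single_edge: "fin_model (hypergraph_thy k) (single_edge k)"
proof -
  have sym: "distinct ys \<and> set ys = {..<k}" if "distinct xs \<and> set xs = {..<k}" "mset ys = mset xs" for xs ys :: "nat list"
    using that mset_eq_setD[OF that(2)] mset_eq_imp_distinct_iff[OF that(2)] by simp
  have len: "length xs = k" if "distinct xs" "set xs = {..<k}" for xs
    using that distinct_card[of xs] by simp
  show ?thesis
    unfolding fin_model_def model_def is_structure_def hypergraph_thy_def single_edge_def
    by simp (use sym len in blast)
qed

lemma isomorphic_single_edge_iff:
  assumes "model (hypergraph_thy k) G" "verts G = {..<k}"
  shows "isomorphic G (single_edge k) \<longleftrightarrow> [0..<k] \<in> rels G ()"
proof
  assume "isomorphic G (single_edge k)"
  then obtain f where f: "bij_betw f {..<k} {..<k}" 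
    and r: "\<And>xs. set xs \<subseteq> {..<k} \<Longrightarrow> (xs \<in> rels G () \<longleftrightarrow> distinct (map f xs) \<and> set (map f xs) = {..<k})"
    unfolding isomorphic_def is_iso_def assms(2) by (auto simp: single_edge_def)
  have "set [0..<k] \<subseteq> {..<k}" by auto
  from r[OF this] f show "[0..<k] \<in> rels G ()"
    by (auto simp: bij_betw_def distinct_map atLeast0LessThan)
next
  assume edge: "[0..<k] \<in> rels G ()"
  have "xs \<in> rels G () \<longleftrightarrow> distinct xs \<and> set xs = {..<k}" if "set xs \<subseteq> {..<k}" for xs
  proof
    assume "xs \<in> rels G ()"
    then have "distinct xs" "length xs = k"
      using assms(1) by (auto simp: model_def is_structure_def hypergraph_thy_def)
    then show "distinct xs \<and> set xs = {..<k}" using that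
      by (metis card_lessThan card_subset_eq distinct_card finite_lessThan)
  next
    assume "distinct xs \<and> set xs = {..<k}"
    then have "mset xs = mset [0..<k]" 
      by (subst set_eq_iff_mset_eq_distinct[symmetric]) (auto simp: atLeast0LessThan)
    moreover have "ax (hypergraph_thy k) G" using assms(1) by (simp add: model_def)
    ultimately show "xs \<in> rels G ()" using edge unfolding hypergraph_thy_def by fastforce
  qed
  then have "is_iso id G (single_edge k)"
    using assms(2) by (simp add: is_iso_def single_edge_def)
  then show "isomorphic G (single_edge k)" unfolding isomorphic_def by blast
qed

section \<open>The hypergraph inside an arbitrary coupling\<close>

lemma prob_eq_expectation:
  "\<P>(\<theta> in cube UNIV. R \<theta>) = cube.expectation UNIV (\<lambda>\<theta>. of_bool (R \<theta>))"
proof -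
  have "(\<lambda>\<theta>. of_bool (R \<theta>)) = indicat_real {\<theta>. R \<theta>}" by (auto simp: fun_eq_iff)
  then show ?thesis by (simp add: Int_def conj_commute)
qed

locale hypergraph_coupling =
  fixes k :: nat and T' :: "'q canon_thy" and \<phi> \<psi> \<xi> \<N>
  assumes T': "hereditary T'" and coup: "coupling (hypergraph_thy k) T' \<phi> \<psi> \<xi>"
    and rep: "represents (union_thy (hypergraph_thy k) T') \<N> \<xi>"
begin

abbreviation "T \<equiv> hypergraph_thy k"
abbreviation "U \<equiv> union_thy T T'"
abbreviation "K \<equiv> array U \<N>"

lemma U: "hereditary U"
  by (rule hereditary_union[OF hereditary_hypergraph T'])

lemma AE_model: "AE \<theta> in cube UNIV. model U (K \<theta>)"
  using rep by (simp add: represents_def)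

lemma pred_K: "Measurable.pred (cube UNIV) (\<lambda>\<theta>. xs \<in> rels (K \<theta>) P)"
  by (rule pred_rels_array[OF represents_measurable[OF rep]])

lemma measurable_induced_K: "(\<lambda>\<theta>. induced (K \<theta>) {..<m}) \<in> measurable (cube UNIV) (count_space UNIV)"
  using measurable_induced_array[OF represents_measurable[OF rep]] U by (simp add: hereditary_def)

lemma prob_edge: 
  "\<P>(\<theta> in cube UNIV. [0..<k] \<in> rels (K \<theta>) (Inl ())) = \<phi> (iso_class T (single_edge k))"
proof -
  let ?C = "iso_class T (single_edge k)"
  note [measurable] = pred_K
  define F where "F C = (of_bool (C = ?C) :: real)" for C
  have C: "?C \<in> classes T k" using fin_model_single_edge unfolding classes_def
    by (intro image_eqI[OF refl]) (auto simp: single_edge_def)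
  have fin: "finite (classes T k)" using hereditary_hypergraph by (intro finite_classes) (simp add: hereditary_def)
  have "\<P>(\<theta> in cube UNIV. [0..<k] \<in> rels (K \<theta>) (Inl ())) = 
      cube.expectation UNIV (\<lambda>\<theta>. of_bool ([0..<k] \<in> rels (K \<theta>) (Inl ())))"
    by (simp add: prob_eq_expectation)
  also have "\<dots> = cube.expectation UNIV (\<lambda>\<theta>. F (iso_class T (reductL (induced (K \<theta>) {..<k}))))"
  proof (rule integral_cong_AE)
    show "AE \<theta> in cube UNIV. of_bool ([0..<k] \<in> rels (K \<theta>) (Inl ())) = 
        F (iso_class T (reductL (induced (K \<theta>) {..<k})))"
      using AE_model
    proof eventually_elim
      case (elim \<theta>)
      let ?G = "reductL (induced (K \<theta>) {..<k})"
      have G: "fin_model T ?G" 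
        using fin_model_induced[OF U elim, of "{..<k}"] by (simp add: fin_model_union_iff)
      moreover have "verts ?G = {..<k}" by (simp add: array_def)
      ultimately have "isomorphic ?G (single_edge k) \<longleftrightarrow> [0..<k] \<in> rels ?G ()"
        by (intro isomorphic_single_edge_iff) (simp_all add: fin_model_def)
      also have "\<dots> \<longleftrightarrow> [0..<k] \<in> rels (K \<theta>) (Inl ())" by (auto simp: induced_def)
      finally show ?case unfolding F_def iso_class_eq_iff[OF G] by simp
    qed
  qed (measurable, rule measurable_compose[OF measurable_induced_K], simp)
  also have "\<dots> = (\<Sum>C\<in>classes T k. F C * \<phi> C)"
    by (rule expectation_reductL[OF hereditary_hypergraph T' coup rep])
  also have "\<dots> = \<phi> ?C"
    unfolding F_def using C fin by (simp add: of_bool_def if_distribR if_distrib cong: if_cong)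
  finally show ?thesis .
qed

text \<open>The expectation is a functional of \<open>\<phi>\<close>, hence a limit of averages over
  the vertex subsets of size 2k in \<open>N n\<close>, each of them nonpositive by
  \<open>oct\<close>.\<close>

lemma expectation_octahedron_sum:
  fixes N :: "nat \<Rightarrow> unit struc"
  assumes N: "\<And>n. fin_model T (N n)"
    and lim: "\<And>M. fin_model T M \<Longrightarrow> (\<lambda>n. ind_density M (N n)) \<longlonglongrightarrow> \<phi> (iso_class T M)"
    and oct: "\<And>n. (\<Sum>W\<in>sub (2 * k) (N n). octahedron_sum k (induced (N n) W)) \<le> 0"
  shows "cube.expectation UNIV (\<lambda>\<theta>. octahedron_sum k (reductL (induced (K \<theta>) {..<2 * k}))) \<le> 0"
proof -
  define F where "F C = octahedron_sum k (SOME G. G \<in> C)" for C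
  have F: "F (iso_class T G) = octahedron_sum k G" if "fin_model T G" "card (verts G) = 2 * k" for G
  proof -
    have "(SOME G'. G' \<in> iso_class T G) \<in> iso_class T G"
      using that by (intro someI[of "\<lambda>G'. G' \<in> iso_class T G" G]) (simp add: mem_iso_class)
    then have "isomorphic G (SOME G'. G' \<in> iso_class T G)" by (simp add: mem_iso_class)
    from octahedron_sum_cong[OF this that(2)] show ?thesis unfolding F_def by simp
  qed
  have "cube.expectation UNIV (\<lambda>\<theta>. octahedron_sum k (reductL (induced (K \<theta>) {..<2 * k}))) =
     cube.expectation UNIV (\<lambda>\<theta>. F (iso_class T (reductL (induced (K \<theta>) {..<2 * k}))))"
  proof (rule integral_cong_AE)
    show "AE \<theta> in cube UNIV. octahedron_sum k (reductL (induced (K \<theta>) {..<2 * k})) =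
        F (iso_class T (reductL (induced (K \<theta>) {..<2 * k})))"
      using AE_model
    proof eventually_elim
      case (elim \<theta>)
      have "fin_model T (reductL (induced (K \<theta>) {..<2 * k}))" 
        using fin_model_induced[OF U elim, of "{..<2 * k}"] by (simp add: fin_model_union_iff)
      then show ?case by (subst F) (simp_all add: array_def)
    qed
  qed (rule measurable_compose[OF measurable_induced_K]; simp)+
  also have "\<dots> = (\<Sum>C\<in>classes T (2 * k). F C * \<phi> C)"
    by (rule expectation_reductL[OF hereditary_hypergraph T' coup rep])
  also have "\<dots> \<le> 0"
  proof (rule LIMSEQ_le_const2)
    show "(\<lambda>n. (\<Sum>W\<in>sub (2 * k) (N n). F (iso_class T (induced (N n) W))) / real (card (verts (N n)) choose (2 * k)))
     \<longlonglongrightarrow> (\<Sum>C\<in>classes T (2 * k). F C * \<phi> C)"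
      by (rule subset_average_tendsto[OF hereditary_hypergraph N lim])
    have "(\<Sum>W\<in>sub (2 * k) (N n). F (iso_class T (induced (N n) W))) = 
       (\<Sum>W\<in>sub (2 * k) (N n). octahedron_sum k (induced (N n) W))" for n
      using sub_facts[OF hereditary_hypergraph N] by (intro sum.cong refl F) auto
    then show "\<exists>n0. \<forall>n\<ge>n0. (\<Sum>W\<in>sub (2 * k) (N n). F (iso_class T (induced (N n) W))) / 
       real (card (verts (N n)) choose (2 * k)) \<le> 0"
      using oct by (auto intro!: divide_nonpos_nonneg)
  qed
  finally show ?thesis .
qed

text \<open>The switch \<open>b\<close> covers two uses: with \<open>True\<close> the predicates of
  Dev appear, with \<open>False\<close> all factors are 1 and the sign itself has mean zero, that
  is, the edge density is 1/2.\<close>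

lemma edge_sign_orthogonal:
  fixes N :: "nat \<Rightarrow> unit struc" and L :: "nat \<Rightarrow> nat list" and P :: "nat \<Rightarrow> 'q" and b :: bool
  assumes N: "\<And>n. fin_model T (N n)"
    and lim: "\<And>M. fin_model T M \<Longrightarrow> (\<lambda>n. ind_density M (N n)) \<longlonglongrightarrow> \<phi> (iso_class T M)"
    and oct: "\<And>n. (\<Sum>W\<in>sub (2 * k) (N n). octahedron_sum k (induced (N n) W)) \<le> 0"
    and k: "k \<ge> 2" and L: "\<And>j. j \<notin> set (L j)"
  shows "cube.expectation UNIV (\<lambda>\<theta>. edge_sign (reductL (K \<theta>)) [0..<k] * 
     (\<Prod>j\<in>{0<..<k}. of_bool (b \<longrightarrow> L j \<in> rels (K \<theta>) (Inr (P j))))) = 0"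
proof -
  define s where "s x \<theta> = edge_sign (reductL (K \<theta>)) (map x [0..<k])" for x \<theta>
  define Q where "Q j x \<theta> = (of_bool (b \<longrightarrow> map x (L j) \<in> rels (K \<theta>) (Inr (P j))) :: real)" for j x \<theta>
  note [measurable] = pred_K
  interpret doubling "cube UNIV" k s Q
  proof
    show "s x \<in> borel_measurable (cube UNIV)" for x unfolding s_def edge_sign_def by simp
    show "Q j x \<in> borel_measurable (cube UNIV)" for j x unfolding Q_def by simp
    show "\<bar>s x \<theta>\<bar> \<le> 1" for x \<theta> by (simp add: s_def edge_sign_def)
    show "\<bar>Q j x \<theta>\<bar> \<le> 1" for j x \<theta> by (simp add: Q_def)
    show "Q j (x(j := y)) = Q j x" for j x y
      using L[of j] unfolding Q_def by (simp add: map_fun_upd)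
  qed
  have f_relabel: "f t (\<lambda>i. \<sigma> (x i)) \<theta> = f t x (relabel \<sigma> \<theta>)" if "inj \<sigma>" for t \<sigma> x \<theta>
  proof -
    have "map (\<lambda>i. \<sigma> (x i)) xs \<in> rels (K \<theta>) R \<longleftrightarrow> map x xs \<in> rels (K (relabel \<sigma> \<theta>)) R" for xs R
      unfolding rels_array_relabel[OF that] by (simp add: o_def)
    then show ?thesis by (simp add: f_def s_def Q_def edge_sign_def)
  qed
  have exch: "cube.expectation UNIV (W t \<sigma>) = cube.expectation UNIV (W t id)" if "inj \<sigma>" for t \<sigma>
  proof -
    have eq: "W t \<sigma> = (\<lambda>\<theta>. W t id (relabel \<sigma> \<theta>))"
      unfolding W_def corner_def id_apply using f_relabel[OF that] by (simp add: fun_eq_iff)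
    have "W t id \<in> borel_measurable (cube UNIV)" unfolding W_def by measurable
    from expectation_relabel[OF that this] show ?thesis unfolding eq .
  qed
  have "cube.expectation UNIV (W (k - 1) id) \<le> 0"
  proof -
    let ?V = "{..<2 * k}"
    have W_integrable: "integrable (cube UNIV) (W (k - 1) \<sigma>)" for \<sigma>
    proof (rule cube.integrable_const_bound[where B=1])
      show "AE \<theta> in cube UNIV. norm (W (k - 1) \<sigma> \<theta>) \<le> 1"
        unfolding W_def real_norm_def by (intro AE_I2 prod_abs_le_1 f_bd)
      show "W (k - 1) \<sigma> \<in> borel_measurable (cube UNIV)" unfolding W_def by measurable
    qed
    \<comment> \<open>An ordering of the first 2k vertices extends by the identity to an injection.
      By exchangeability all orderings give the same expectation, so the octahedral sum has mean
      (2k)! times that of \<open>W (k - 1) id\<close>.\<close>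
    define \<sigma> where "\<sigma> ys n = (if n < 2 * k then ys ! n else n)" for ys :: "nat list" and n
    have inj: "inj (\<sigma> ys)" if "ys \<in> permutations_of_set ?V" for ys
    proof -
      have "distinct ys" "set ys = ?V" "length ys = 2 * k"
        using that by (simp_all add: permutations_of_set_def length_finite_permutations_of_set)
      then have "ys ! n < 2 * k" if "n < 2 * k" for n using that nth_mem[of n ys] by auto
      then show ?thesis using \<open>distinct ys\<close> \<open>length ys = 2 * k\<close>
        by (intro injI) (auto simp: \<sigma>_def nth_eq_iff_index_eq split: if_split_asm; metis)
    qed
    have "octahedron_sum k (reductL (induced (K \<theta>) ?V)) = 
        (\<Sum>ys\<in>permutations_of_set ?V. W (k - 1) (\<sigma> ys) \<theta>)" for \<theta>
    proof -
      have "edge_sign (reductL (induced (K \<theta>) ?V)) (map (\<lambda>i. ys ! (2 * i + of_bool (i \<in> e))) [0..<k])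
         = f (k - 1) (corner (\<sigma> ys) e) \<theta>" if ys: "ys \<in> permutations_of_set ?V" for ys e
      proof -
        have ys': "set ys = ?V" "length ys = 2 * k"
          using ys by (auto simp: permutations_of_set_def length_finite_permutations_of_set)
        let ?xs = "map (\<lambda>i. ys ! (2 * i + of_bool (i \<in> e))) [0..<k]"
        have eq: "?xs = map (corner (\<sigma> ys) e) [0..<k]"
          using octahedron_index by (auto simp: corner_def \<sigma>_def)
        have "set ?xs \<subseteq> ?V"
          using ys' octahedron_index nth_mem[of _ ys] by force
        moreover have "{k - 1<..<k} = {}" by auto
        ultimately show ?thesis unfolding eq f_def s_def edge_sign_def by (simp add: induced_def)
      qed
      moreover have "verts (reductL (induced (K \<theta>) ?V)) = ?V" by (simp add: array_def)
      ultimately show ?thesis unfolding octahedron_sum_def W_def by simp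
    qed
    then have "(\<Sum>ys\<in>permutations_of_set ?V. cube.expectation UNIV (W (k - 1) (\<sigma> ys))) = 
        cube.expectation UNIV (\<lambda>\<theta>. octahedron_sum k (reductL (induced (K \<theta>) ?V)))"
      using W_integrable by (simp add: Bochner_Integration.integral_sum)
    also have "\<dots> \<le> 0" by (rule expectation_octahedron_sum[OF N lim oct])
    also have "(\<Sum>ys\<in>permutations_of_set ?V. cube.expectation UNIV (W (k - 1) (\<sigma> ys))) =
        (\<Sum>ys\<in>permutations_of_set ?V. cube.expectation UNIV (W (k - 1) id))"
      by (intro sum.cong refl exch inj)
    finally have "real (card (permutations_of_set ?V)) * cube.expectation UNIV (W (k - 1) id) \<le> 0"
      by simp
    moreover have "card (permutations_of_set ?V) > 0" by (simp add: card_permutations_of_set)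
    ultimately show ?thesis by (meson mult_pos_pos not_le of_nat_0_less_iff)
  qed
  then have "cube.expectation UNIV (f 0 (\<lambda>i. 2 * i)) = 0"
    by (intro expectation_eq_0 k exch)
  \<comment> \<open>Doubling left the edge on the even vertices; relabelling moves it back to 0,
    ..., k - 1.\<close>
  moreover have "f 0 (\<lambda>i. 2 * i) = (\<lambda>\<theta>. f 0 id (relabel (\<lambda>i. 2 * i) \<theta>))"
    using f_relabel[of "\<lambda>i. 2 * i" 0 id] by (auto simp: fun_eq_iff inj_def)
  ultimately have "cube.expectation UNIV (f 0 id) = 0"
    using expectation_relabel[of "\<lambda>i. 2 * i" "f 0 id"] by (simp add: inj_def)
  moreover have "f 0 id = (\<lambda>\<theta>. edge_sign (reductL (K \<theta>)) [0..<k] * 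
      (\<Prod>j\<in>{0<..<k}. of_bool (b \<longrightarrow> L j \<in> rels (K \<theta>) (Inr (P j)))))"
    by (simp add: fun_eq_iff f_def s_def Q_def)
  ultimately show ?thesis by simp
qed

end

text \<open>Indexing a set by the vertex j \<ge> 1 that it omits makes its predicate fit
  \<open>Q j\<close>; vertex 0 is omitted by no member and so never has to be doubled.\<close>

lemma Dev_family:
  assumes "k \<ge> 2"
  shows "{A. A \<subseteq> {..<k} \<and> card A = k - 1 \<and> 0 \<in> A} = (\<lambda>j. {..<k} - {j}) ` {0<..<k}"
proof (intro equalityI subsetI)
  fix A assume "A \<in> {A. A \<subseteq> {..<k} \<and> card A = k - 1 \<and> 0 \<in> A}"
  then have A: "A \<subseteq> {..<k}" "card A = k - 1" "0 \<in> A" by auto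
  then have "card ({..<k} - A) = 1" using assms by (subst card_Diff_subset) (auto intro: finite_subset)
  then obtain j where "{..<k} - A = {j}" by (auto simp: card_1_singleton_iff)
  then have "A = {..<k} - {j}" "j \<in> {0<..<k}" using A by (auto intro: gr0I)
  then show "A \<in> (\<lambda>j. {..<k} - {j}) ` {0<..<k}" by blast
qed auto

text \<open>A set of cardinality 0 inside \<open>{..<1}\<close> cannot contain 0, so the family is
  empty and both sides equal the edge density.\<close>

lemma Dev_1: "Dev_km1 1 \<phi>"
proof -
  have empty: "{A. A \<subseteq> {..<1::nat} \<and> card A = 1 - 1 \<and> 0 \<in> A} = {}" by (auto dest: finite_subset)
  show ?thesis
    unfolding Dev_km1_def Disc_def Let_def empty
  proof (intro ballI allI impI)
    let ?U = "union_thy (hypergraph_thy 1) (pure_thy ({} :: nat set set) card)"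
    fix \<psi> \<xi> \<N>
    assume "coupling (hypergraph_thy 1) (pure_thy ({} :: nat set set) card) \<phi> \<psi> \<xi>" "represents ?U \<N> \<xi>"
    then interpret hypergraph_coupling 1 "pure_thy ({} :: nat set set) card" \<phi> \<psi> \<xi> \<N>
      by unfold_locales (auto intro!: hereditary_pure)
    show "\<P>(\<theta> in cube UNIV. [0..<1] \<in> rels (K \<theta>) (Inl ()) \<and> 
        (\<forall>A\<in>{}. sorted_list_of_set A \<in> rels (K \<theta>) (Inr A))) =
      \<phi> (iso_class (hypergraph_thy 1) (single_edge 1)) *
        \<P>(\<theta> in cube UNIV. \<forall>A\<in>{}. sorted_list_of_set A \<in> rels (K \<theta>) (Inr A))"
      using prob_edge by (simp add: cube.prob_space)
  qed
qed

lemma Dev_of_octahedron_sum: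
  fixes N :: "nat \<Rightarrow> unit struc"
  assumes N: "\<And>n. fin_model (hypergraph_thy k) (N n)"
    and lim: "\<And>M. fin_model (hypergraph_thy k) M \<Longrightarrow> 
      (\<lambda>n. ind_density M (N n)) \<longlonglongrightarrow> \<phi> (iso_class (hypergraph_thy k) M)"
    and oct: "\<And>n. (\<Sum>W\<in>sub (2 * k) (N n). octahedron_sum k (induced (N n) W)) \<le> 0"
    and k: "k \<ge> 2"
  shows "Dev_km1 k \<phi>"
  unfolding Dev_km1_def Disc_def Let_def
proof (intro ballI allI impI)
  let ?A = "{A. A \<subseteq> {..<k} \<and> card A = k - 1 \<and> 0 \<in> A}"
  let ?T = "hypergraph_thy k" and ?T' = "pure_thy ?A card"
  let ?U = "union_thy ?T ?T'"
  fix \<psi> \<xi> \<N>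
  assume "coupling ?T ?T' \<phi> \<psi> \<xi>" "represents ?U \<N> \<xi>"
  then interpret hypergraph_coupling k ?T' \<phi> \<psi> \<xi> \<N>
    by unfold_locales (auto intro!: hereditary_pure)
  let ?L = "\<lambda>j. sorted_list_of_set ({..<k} - {j})" and ?P = "\<lambda>j. {..<k} - {j}"
  define \<pi> where "\<pi> b \<theta> = (\<Prod>j\<in>{0<..<k}. of_bool (b \<longrightarrow> ?L j \<in> rels (K \<theta>) (Inr (?P j))) :: real)" for b \<theta>
  note [measurable] = pred_K
  have orth: "cube.expectation UNIV (\<lambda>\<theta>. edge_sign (reductL (K \<theta>)) [0..<k] * \<pi> b \<theta>) = 0" for b
    unfolding \<pi>_def by (rule edge_sign_orthogonal[OF N lim oct k]) auto
  have \<pi>: "\<pi> b \<theta> = of_bool (b \<longrightarrow> (\<forall>A\<in>?A. sorted_list_of_set A \<in> rels (K \<theta>) (Inr A)))" for b \<theta>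
    unfolding \<pi>_def Dev_family[OF k] by (auto simp: of_bool_def)
  have [measurable]: "\<pi> b \<in> borel_measurable (cube UNIV)" for b unfolding \<pi>_def by measurable
  have [measurable]: "(\<lambda>\<theta>. edge_sign (reductL (K \<theta>)) [0..<k]) \<in> borel_measurable (cube UNIV)" 
    unfolding edge_sign_def rels_reduct by measurable
  \<comment> \<open>The indicator of an edge is (1 - sign) / 2, and \<open>orth\<close> removes the
    part with the sign. Taking \<open>b\<close> false identifies the density, taking it true gives
    Dev.\<close>
  have half: "\<P>(\<theta> in cube UNIV. [0..<k] \<in> rels (K \<theta>) (Inl ()) \<and> 
      (b \<longrightarrow> (\<forall>A\<in>?A. sorted_list_of_set A \<in> rels (K \<theta>) (Inr A))))
    = cube.expectation UNIV (\<pi> b) / 2" for b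
  proof -
    have "\<P>(\<theta> in cube UNIV. [0..<k] \<in> rels (K \<theta>) (Inl ()) \<and> 
        (b \<longrightarrow> (\<forall>A\<in>?A. sorted_list_of_set A \<in> rels (K \<theta>) (Inr A))))
      = cube.expectation UNIV (\<lambda>\<theta>. (\<pi> b \<theta> - edge_sign (reductL (K \<theta>)) [0..<k] * \<pi> b \<theta>) / 2)"
      unfolding prob_eq_expectation
      by (intro Bochner_Integration.integral_cong refl) (simp add: \<pi> edge_sign_def)
    also have "\<dots> = (cube.expectation UNIV (\<pi> b) - 
        cube.expectation UNIV (\<lambda>\<theta>. edge_sign (reductL (K \<theta>)) [0..<k] * \<pi> b \<theta>)) / 2"
    proof -
      have "integrable (cube UNIV) (\<pi> b)" 
        by (rule cube.integrable_const_bound[where B=1]) (simp_all add: \<pi>)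
      moreover have "integrable (cube UNIV) (\<lambda>\<theta>. edge_sign (reductL (K \<theta>)) [0..<k] * \<pi> b \<theta>)"
        by (rule cube.integrable_const_bound[where B=1]) (simp add: \<pi> edge_sign_def, measurable)
      ultimately show ?thesis by simp
    qed
    finally show ?thesis unfolding orth diff_zero .
  qed
  have density: "\<phi> (iso_class ?T (single_edge k)) = 1 / 2"
  proof -
    have "\<pi> False = (\<lambda>_. 1)" by (simp add: fun_eq_iff \<pi>)
    then show ?thesis using half[of False] prob_edge by (simp add: cube.prob_space)
  qed
  have \<pi>_True: "cube.expectation UNIV (\<pi> True) = 
      \<P>(\<theta> in cube UNIV. \<forall>A\<in>?A. sorted_list_of_set A \<in> rels (K \<theta>) (Inr A))"
    unfolding prob_eq_expectation by (intro Bochner_Integration.integral_cong refl) (simp add: \<pi>)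
  show "\<P>(\<theta> in cube UNIV. [0..<k] \<in> rels (K \<theta>) (Inl ()) \<and> 
      (\<forall>A\<in>?A. sorted_list_of_set A \<in> rels (K \<theta>) (Inr A))) =
    \<phi> (iso_class ?T (single_edge k)) *
      \<P>(\<theta> in cube UNIV. \<forall>A\<in>?A. sorted_list_of_set A \<in> rels (K \<theta>) (Inr A))"
    using half[of True] unfolding density \<pi>_True simp_thms by (simp only: times_divide_eq_left mult_1)
qed

section \<open>The hypergraphs\<close>

text \<open>
  The set \<open>D\<close> collects the \<open>(k - 1)\<close>-sets of sign \<open>-1\<close>. The second factor is what the
  vertex set \<open>{..<n}\<close> detects.
\<close>

definition set_sign :: "nat set set \<Rightarrow> nat \<Rightarrow> nat set \<Rightarrow> real" where
  "set_sign D n S = (\<Prod>v\<in>S. if S - {v} \<in> D then -1 else 1) * (if S \<inter> {..<n} = {} then -1 else 1)"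

text \<open>Half of the vertices are marked, so that all-marked sets and sets with exactly one
  marked vertex both keep positive density in the limit.\<close>

definition marked_hypergraph :: "nat \<Rightarrow> nat \<Rightarrow> nat set set \<Rightarrow> (unit + unit) struc" where
  "marked_hypergraph k n D = \<lparr>verts = {..<2 * n}, rels = case_sum
     (\<lambda>_. {xs. distinct xs \<and> length xs = k \<and> set xs \<subseteq> {..<2 * n} \<and> set_sign D n (set xs) = -1})
     (\<lambda>_. {[v] |v. v < n})\<rparr>"

lemma set_sign_cases: "set_sign D n S = 1 \<or> set_sign D n S = -1"
proof -
  have "(\<Prod>v\<in>S. if P v then -1 else 1 :: real) \<in> {1, -1}" for P
    by (induction S rule: infinite_finite_induct) auto
  from this[of "\<lambda>v. S - {v} \<in> D"] show ?thesis by (auto simp: set_sign_def)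
qed

lemma verts_marked_hypergraph [simp]: "verts (marked_hypergraph k n D) = {..<2 * n}"
  by (simp add: marked_hypergraph_def)

lemma fin_model_marked_hypergraph:
  "fin_model (union_thy (hypergraph_thy k) (hypergraph_thy 1)) (marked_hypergraph k n D)"
proof -
  have "ys \<in> rels (marked_hypergraph k n D) (Inl ())" 
    if "xs \<in> rels (marked_hypergraph k n D) (Inl ())" "mset ys = mset xs" for xs ys
    using that mset_eq_setD[OF that(2)] mset_eq_imp_distinct_iff[OF that(2)] mset_eq_length[OF that(2)]
    by (simp add: marked_hypergraph_def)
  moreover have "ys \<in> rels (marked_hypergraph k n D) (Inr ())" 
    if "xs \<in> rels (marked_hypergraph k n D) (Inr ())" "mset ys = mset xs" for xs ys
    using that by (auto simp: marked_hypergraph_def)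
  moreover have "length xs = k \<and> set xs \<subseteq> {..<2 * n} \<and> distinct xs" 
    if "xs \<in> rels (marked_hypergraph k n D) (Inl ())" for xs
    using that by (simp add: marked_hypergraph_def)
  moreover have "length xs = 1 \<and> set xs \<subseteq> {..<2 * n} \<and> distinct xs" 
    if "xs \<in> rels (marked_hypergraph k n D) (Inr ())" for xs
    using that by (auto simp: marked_hypergraph_def)
  ultimately show ?thesis
    unfolding fin_model_union_iff
    by (simp add: fin_model_def model_def is_structure_def hypergraph_thy_def) blast
qed

lemma edge_sign_marked_hypergraph:
  assumes "distinct xs" "length xs = k" "set xs \<subseteq> W" "W \<subseteq> {..<2 * n}"
  shows "edge_sign (induced (reductL (marked_hypergraph k n D)) W) xs = set_sign D n (set xs)"
  using assms set_sign_cases[of D n "set xs"]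
  by (auto simp: edge_sign_def induced_def marked_hypergraph_def)

section \<open>Flipping the sign of one set\<close>

abbreviation toggle :: "nat set \<Rightarrow> nat set set \<Rightarrow> nat set set" where
  "toggle B D \<equiv> sym_diff D {B}"

lemma toggle_toggle: "toggle B (toggle B D) = D"
  by auto

lemma set_sign_toggle_other: "(\<And>v. v \<in> S \<Longrightarrow> S - {v} \<noteq> B) \<Longrightarrow> set_sign (toggle B D) n S = set_sign D n S"
  unfolding set_sign_def by (intro arg_cong2[where f="(*)"] prod.cong refl) auto

text \<open>Distinct elements of \<open>S\<close> have distinct complements in \<open>S\<close>, so
  exactly one factor changes.\<close>

lemma set_sign_toggle_facet:
  assumes "finite S" "v \<in> S"
  shows "set_sign (toggle (S - {v}) D) n S = - set_sign D n S"
proof -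
  have "S - {w} \<noteq> S - {v}" if "w \<in> S - {v}" for w using that assms(2) by blast
  then have "(\<Prod>w\<in>S - {v}. if S - {w} \<in> toggle (S - {v}) D then -1 else 1 :: real) =
      (\<Prod>w\<in>S - {v}. if S - {w} \<in> D then -1 else 1)"
    by (intro prod.cong refl) auto
  then show ?thesis unfolding set_sign_def prod.remove[OF assms] by auto
qed

text \<open>Toggling is an involution on the families, and it maps the sum to its negative.\<close>

lemma sum_toggle:
  fixes g :: "nat set set \<Rightarrow> real"
  assumes "B \<subseteq> V" "\<And>D. g (toggle B D) = - g D"
  shows "(\<Sum>D\<in>Pow (Pow V). g D) = 0"
proof -
  have "(\<Sum>D\<in>Pow (Pow V). g D) = (\<Sum>D\<in>Pow (Pow V). g (toggle B D))"
    by (rule sum.reindex_bij_witness[of _ "toggle B" "toggle B"]) (use assms(1) in \<open>auto simp: toggle_toggle\<close>)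
  also have "\<dots> = - (\<Sum>D\<in>Pow (Pow V). g D)" by (simp add: assms(2) sum_negf)
  finally show ?thesis by simp
qed

text \<open>
  The \<open>(k - 1)\<close>-set of the uncopied vertices other than the first one is a facet of exactly one
  of the edges of the octahedron, so flipping its sign flips the product.
\<close>

lemma sum_octahedron_zero:
  assumes k: "k \<ge> 1" and W: "W \<subseteq> {..<2 * n}" "card W = 2 * k"
  shows "(\<Sum>D\<in>Pow (Pow {..<2 * n}). 
    octahedron_sum k (induced (reductL (marked_hypergraph k n D)) W)) = 0"
proof -
  have "(\<Sum>D\<in>Pow (Pow {..<2 * n}). \<Prod>e\<in>Pow {1..k - 1}. edge_sign (induced (reductL (marked_hypergraph k n D)) W)
     (map (\<lambda>i. ys ! (2 * i + of_bool (i \<in> e))) [0..<k])) = 0" if ys: "ys \<in> permutations_of_set W" for ys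
  proof -
    have dist: "distinct ys" and set: "set ys = W" and len: "length ys = 2 * k"
      using ys W by (auto simp: permutations_of_set_def distinct_card[symmetric])
    let ?xs = "\<lambda>e. map (\<lambda>i. ys ! (2 * i + of_bool (i \<in> e))) [0..<k]"
    have nth: "ys ! i = ys ! j \<longleftrightarrow> i = j" if "i < 2 * k" "j < 2 * k" for i j
      using that dist len by (simp add: nth_eq_iff_index_eq)
    have even_odd: "2 * i + of_bool b = 2 * j + of_bool c \<longleftrightarrow> i = j \<and> b = c" for i j :: nat and b c
      by (cases b; cases c; simp; presburger)
    have xs: "distinct (?xs e)" "length (?xs e) = k" "set (?xs e) \<subseteq> W" for e
      using set len octahedron_index nth_mem[of _ ys]
      by (auto simp: distinct_map inj_on_def nth even_odd) 
    have "(\<Sum>D\<in>Pow (Pow {..<2 * n}). \<Prod>e\<in>Pow {1..k - 1}. set_sign D n (set (?xs e))) = 0"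
    proof (rule sum_toggle)
      let ?B = "set (?xs {}) - {ys ! 0}"
      show "?B \<subseteq> {..<2 * n}" using xs(3)[of "{}"] W by blast
      fix D
      \<comment> \<open>A nonempty \<open>e\<close> replaces some role i \<ge> 1 by its second copy,
        so this edge misses the element \<open>ys ! (2 * i)\<close> of \<open>?B\<close> and cannot
        have \<open>?B\<close> as a facet.\<close>
      have "set_sign (toggle ?B D) n (set (?xs e)) = set_sign D n (set (?xs e))"
        if e: "e \<in> Pow {1..k - 1} - {{}}" for e
      proof (rule set_sign_toggle_other)
        fix v
        from e obtain i where i: "i \<in> e" "1 \<le> i" "i < k" by fastforce
        then have "ys ! (2 * i) \<in> ?B" using nth[of "2 * i" 0] by force
        moreover have "ys ! (2 * i) \<notin> set (?xs e)"
        proof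
          assume "ys ! (2 * i) \<in> set (?xs e)"
          then obtain j where "j < k" "ys ! (2 * i + of_bool False) = ys ! (2 * j + of_bool (j \<in> e))" by auto
          then have "2 * i + of_bool False = 2 * j + of_bool (j \<in> e)" 
            using nth octahedron_index i(3) by blast
          then show False using i(1) unfolding even_odd by auto
        qed
        ultimately show "set (?xs e) - {v} \<noteq> ?B" by blast
      qed
      moreover have "set_sign (toggle ?B D) n (set (?xs {})) = - set_sign D n (set (?xs {}))"
        using k by (intro set_sign_toggle_facet) (auto intro!: image_eqI[of _ _ 0])
      moreover have "{} \<in> Pow {1..k - 1}" "finite (Pow {1..k - 1})" by auto
      ultimately show "(\<Prod>e\<in>Pow {1..k - 1}. set_sign (toggle ?B D) n (set (?xs e))) =
          - (\<Prod>e\<in>Pow {1..k - 1}. set_sign D n (set (?xs e)))"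
        by (simp only: prod.remove[of "Pow {1..k - 1}" "{}"] mult_minus_left cong: prod.cong)
    qed
    then show ?thesis using edge_sign_marked_hypergraph[OF xs W(1)] by simp
  qed
  moreover have "verts (induced (reductL (marked_hypergraph k n D)) W) = W" for D
    using W by auto
  ultimately show ?thesis
    unfolding octahedron_sum_def by (simp only: sum.swap[of _ "permutations_of_set W"] sum.neutral_const cong: sum.cong)
qed

text \<open>The sum over all \<open>D\<close> is zero for each vertex subset, hence also in total,
  so not every \<open>D\<close> can give a positive value.\<close>

lemma ex_nonpositive_octahedron_sum:
  assumes "k \<ge> 1"
  obtains D where "(\<Sum>W\<in>sub (2 * k) (reductL (marked_hypergraph k n D)). 
     octahedron_sum k (induced (reductL (marked_hypergraph k n D)) W)) \<le> 0"
proof (rule ccontr)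
  let ?g = "\<lambda>D. \<Sum>W | W \<subseteq> {..<2 * n} \<and> card W = 2 * k. 
     octahedron_sum k (induced (reductL (marked_hypergraph k n D)) W)"
  assume "\<not> thesis"
  then have pos: "?g D > 0" for D using that[of D] by (force simp: not_le)
  have "(\<Sum>D\<in>Pow (Pow {..<2 * n}). ?g D) > 0" by (rule sum_pos[OF _ _ pos]) auto
  moreover have "(\<Sum>D\<in>Pow (Pow {..<2 * n}). ?g D) = 0"
  proof (subst sum.swap, rule sum.neutral, rule ballI)
    fix W assume "W \<in> {W. W \<subseteq> {..<2 * n} \<and> card W = 2 * k}"
    then have W: "W \<subseteq> {..<2 * n}" "card W = 2 * k" by auto
    show "(\<Sum>D\<in>Pow (Pow {..<2 * n}). octahedron_sum k (induced (reductL (marked_hypergraph k n D)) W)) = 0"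
      by (rule sum_octahedron_zero[OF assms W])
  qed
  ultimately show False by simp
qed

section \<open>Coboundaries\<close>

text \<open>
  For \<open>k + 1\<close> vertices this is the parity of the number of edges. The \<open>(k - 1)\<close>-sets do not
  contribute, each of them lying in two \<open>k\<close>-sets.
\<close>

definition coboundary :: "unit struc \<Rightarrow> real" where
  "coboundary G = (\<Prod>w\<in>verts G. if \<exists>xs\<in>rels G (). set xs = verts G - {w} then -1 else 1)"

lemma coboundary_cong:
  assumes "isomorphic G G'"
  shows "coboundary G = coboundary G'"
proof -
  from assms obtain f where f: "bij_betw f (verts G) (verts G')"
    and r: "\<And>xs. set xs \<subseteq> verts G \<Longrightarrow> (xs \<in> rels G () \<longleftrightarrow> map f xs \<in> rels G' ())"
    unfolding isomorphic_def is_iso_def by auto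
  have V: "verts G' = f ` verts G" and inj: "inj_on f (verts G)" using f by (auto simp: bij_betw_def)
  have "(\<exists>xs\<in>rels G' (). set xs = verts G' - {f w}) \<longleftrightarrow> (\<exists>xs\<in>rels G (). set xs = verts G - {w})"
    if w: "w \<in> verts G" for w
  proof -
    have im: "f ` (verts G - {w}) = verts G' - {f w}"
      using inj w by (simp add: V inj_on_image_set_diff)
    show ?thesis
    proof
      assume "\<exists>xs\<in>rels G' (). set xs = verts G' - {f w}"
      then obtain xs where xs: "xs \<in> rels G' ()" "set xs = verts G' - {f w}" by blast
      define zs where "zs = map (inv_into (verts G) f) xs"
      have "map f zs = xs" 
        unfolding zs_def using xs(2) by (auto simp: V f_inv_into_f intro!: map_idI)
      moreover have "set zs = verts G - {w}"
        unfolding zs_def set_map xs(2) im[symmetric] using inj by (auto simp: inv_into_image_cancel)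
      ultimately show "\<exists>xs\<in>rels G (). set xs = verts G - {w}"
        using r[of zs] xs(1) by (intro bexI[of _ zs]) auto
    next
      assume "\<exists>xs\<in>rels G (). set xs = verts G - {w}"
      then obtain xs where xs: "xs \<in> rels G ()" "set xs = verts G - {w}" by blast
      then show "\<exists>xs\<in>rels G' (). set xs = verts G' - {f w}"
        using r[of xs] im by (intro bexI[of _ "map f xs"]) auto
    qed
  qed
  then show ?thesis unfolding coboundary_def V prod.reindex[OF inj]
    by (simp add: V[symmetric])
qed

text \<open>Each unordered pair contributes \<open>h v w * h w v\<close>, which is a square and
  equals 1.\<close>

lemma prod_symmetric_pairs:
  fixes h :: "'a \<Rightarrow> 'a \<Rightarrow> real"
  assumes "finite W" "\<And>v w. h v w = h w v" "\<And>v w. h v w * h v w = 1"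
  shows "(\<Prod>w\<in>W. \<Prod>v\<in>W - {w}. h w v) = 1"
  using assms(1)
proof (induction W)
  case (insert x W)
  have "(\<Prod>v\<in>insert x W - {w}. h w v) = h w x * (\<Prod>v\<in>W - {w}. h w v)" if "w \<in> W" for w
  proof -
    have "insert x W - {w} = insert x (W - {w})" using insert(2) that by auto
    then show ?thesis using insert(1,2) by simp
  qed
  then have "(\<Prod>w\<in>insert x W. \<Prod>v\<in>insert x W - {w}. h w v) = 
      (\<Prod>v\<in>W. h x v) * ((\<Prod>w\<in>W. h w x) * (\<Prod>w\<in>W. \<Prod>v\<in>W - {w}. h w v))"
    using insert(1,2) by (simp add: prod.distrib)
  also have "\<dots> = (\<Prod>v\<in>W. h x v * h x v)"
    unfolding insert.IH by (simp add: prod.distrib assms(2)[of _ x])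
  finally show ?case by (simp add: assms(3))
qed simp

text \<open>The facets without a marked vertex are all that is left to count: none if k \<ge> 1 and
  all of \<open>W\<close> is marked, and only \<open>W - {x}\<close> if \<open>x\<close> is the one
  marked vertex.\<close>

lemma coboundary_marked_hypergraph:
  assumes W: "W \<subseteq> {..<2 * n}" "card W = k + 1"
  shows "coboundary (induced (reductL (marked_hypergraph k n D)) W) = 
    (\<Prod>w\<in>W. if (W - {w}) \<inter> {..<n} = {} then -1 else 1)"
proof -
  let ?G = "induced (reductL (marked_hypergraph k n D)) W"
  have fin: "finite W" using W finite_subset by blast
  have verts: "verts ?G = W" using W by auto
  have "(if \<exists>xs\<in>rels ?G (). set xs = W - {w} then -1 else 1) = set_sign D n (W - {w})" if w: "w \<in> W" for w
  proof -
    have "(\<exists>xs\<in>rels ?G (). set xs = W - {w}) \<longleftrightarrow> set_sign D n (W - {w}) = -1"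
    proof
      assume "set_sign D n (W - {w}) = -1"
      then have "sorted_list_of_set (W - {w}) \<in> rels ?G ()"
        using W w fin by (auto simp: induced_def marked_hypergraph_def)
      then show "\<exists>xs\<in>rels ?G (). set xs = W - {w}"
        using fin by (intro bexI[of _ "sorted_list_of_set (W - {w})"]) auto
    qed (auto simp: induced_def marked_hypergraph_def)
    then show ?thesis using set_sign_cases[of D n "W - {w}"] by auto
  qed
  then have "coboundary ?G = (\<Prod>w\<in>W. set_sign D n (W - {w}))"
    unfolding coboundary_def verts by (intro prod.cong refl)
  also have "\<dots> = (\<Prod>w\<in>W. \<Prod>v\<in>W - {w}. if W - {w} - {v} \<in> D then -1 else 1) * 
      (\<Prod>w\<in>W. if (W - {w}) \<inter> {..<n} = {} then -1 else 1)"
    unfolding set_sign_def by (rule prod.distrib)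
  also have "(\<Prod>w\<in>W. \<Prod>v\<in>W - {w}. if W - {w} - {v} \<in> D then -1 else 1 :: real) = 1"
  proof (rule prod_symmetric_pairs[OF fin])
    show "(if W - {v} - {w} \<in> D then -1 else 1 :: real) = (if W - {w} - {v} \<in> D then -1 else 1)" for v w
    proof -
      have "W - {v} - {w} = W - {w} - {v}" by blast
      then show ?thesis by simp
    qed
  qed simp
  finally show ?thesis by simp
qed

lemma coboundary_marked:
  assumes "k \<ge> 1" "W \<subseteq> {..<n}" "card W = k + 1"
  shows "coboundary (induced (reductL (marked_hypergraph k n D)) W) = 1"
proof -
  have "(W - {w}) \<inter> {..<n} \<noteq> {}" if "w \<in> W" for w
  proof -
    have "card (W - {w}) = k" using assms that by simp
    then have "W - {w} \<noteq> {}" using assms(1) by (metis card.empty not_one_le_zero)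
    then show ?thesis using assms(2) by blast
  qed
  moreover have "W \<subseteq> {..<2 * n}" using assms(2) by auto
  ultimately show ?thesis using assms(3) coboundary_marked_hypergraph by simp
qed

lemma coboundary_one_marked:
  assumes "W \<subseteq> {..<2 * n}" "card W = k + 1" "W \<inter> {..<n} = {x}"
  shows "coboundary (induced (reductL (marked_hypergraph k n D)) W) = -1"
proof -
  have "finite W" "x \<in> W" using assms finite_subset by blast+
  moreover have "(W - {w}) \<inter> {..<n} = {} \<longleftrightarrow> w = x" for w using assms(3) by blast
  ultimately show ?thesis using coboundary_marked_hypergraph[OF assms(1,2)] by (simp add: prod.delta)
qed

section \<open>Failure of UInduce\<close>

text \<open>Turns a count of at least (n/m)^m among the subsets of size m of 2n vertices into a
  density bound free of n; the constant is (n/m)^m divided by the bound (2n)^m for the binomial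
  coefficient.\<close>

lemma binomial_ratio_ge:
  assumes "m \<ge> 1" "n \<ge> m" "(real n / real m) ^ m \<le> x"
  shows "(1 / (2 * real m)) ^ m \<le> x / real (2 * n choose m)"
proof -
  have "2 * n choose m \<le> (2 * n) ^ m" using assms by (intro binomial_le_pow) simp
  then have le: "real (2 * n choose m) \<le> (2 * real n) ^ m" by (metis of_nat_le_iff of_nat_mult of_nat_numeral of_nat_power)
  have pos: "real (2 * n choose m) > 0" using assms by simp
  have "(1 / (2 * real m)) ^ m * real (2 * n choose m) \<le> (1 / (2 * real m)) ^ m * (2 * real n) ^ m"
    by (intro mult_left_mono le) simp
  also have "\<dots> = (real n / real m) ^ m" unfolding power_mult_distrib[symmetric] using assms(1) by simp
  also have "\<dots> \<le> x" by (rule assms(3))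
  finally show ?thesis using pos by (simp add: pos_le_divide_eq)
qed

lemma card_aut_pos:
  assumes "finite (verts M)" shows "card (aut M) > 0"
proof -
  have "id \<in> aut M" by (simp add: aut_def permutes_id is_iso_def)
  moreover have "finite (aut M)" using finite_permutations[OF assms] by (rule rev_finite_subset) (auto simp: aut_def)
  ultimately show ?thesis by (auto simp: card_gt_0_iff)
qed

text \<open>An isomorphism preserves the unary relation, so a copy of a fully marked structure lies
  inside the marked vertices, where coboundaries are even.\<close>

lemma coboundary_of_marked_copy:
  assumes k: "k \<ge> 1" and M: "card (verts M) = k + 1" "\<And>v. v \<in> verts M \<Longrightarrow> [v] \<in> rels M (Inr ())"
    and W: "W \<subseteq> {..<2 * n}" and iso: "isomorphic (induced (marked_hypergraph k n D) W) M"
  shows "coboundary (reductL M) = 1"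
proof -
  let ?N = "marked_hypergraph k n D"
  obtain f where f: "bij_betw f (verts (induced ?N W)) (verts M)" 
    "\<And>P xs. set xs \<subseteq> verts (induced ?N W) \<Longrightarrow> (xs \<in> rels (induced ?N W) P \<longleftrightarrow> map f xs \<in> rels M P)"
    using iso unfolding isomorphic_def is_iso_def by blast
  have verts: "verts (induced ?N W) = W" using W by auto
  have "W \<subseteq> {..<n}"
  proof
    fix v assume v: "v \<in> W"
    then have "f v \<in> verts M" using f(1) verts by (auto simp: bij_betw_def)
    then have "[v] \<in> rels (induced ?N W) (Inr ())" using f(2)[of "[v]" "Inr ()"] M(2)[of "f v"] v W by auto
    then show "v \<in> {..<n}" by (simp add: induced_def marked_hypergraph_def)
  qed
  moreover have "card W = k + 1" using isomorphic_card[OF iso] M(1) verts by simp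
  ultimately have "coboundary (reductL (induced ?N W)) = 1"
    unfolding reductL_induced by (rule coboundary_marked[OF k])
  then show ?thesis using coboundary_cong[OF isomorphic_reductL[OF iso]] by simp
qed

text \<open>Every subset of size m of the n marked vertices induces a copy of
  \<open>M\<close>.\<close>

lemma density_all_marked_ge:
  assumes "m \<ge> 1" "n \<ge> m" and M: "card (verts M) = m" "\<And>xs. xs \<in> rels M () \<longleftrightarrow> (\<exists>v\<in>verts M. xs = [v])" "finite (verts M)"
  shows "(1 / (2 * real m)) ^ m \<le> ind_density M (reductR (marked_hypergraph k n D))"
proof -
  let ?N = "reductR (marked_hypergraph k n D)"
  have "isomorphic (induced ?N W) M" if W: "W \<subseteq> {..<n}" "card W = m" for W
  proof -
    have "finite W" using W finite_subset by blast
    then obtain f where f: "bij_betw f W (verts M)" 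
      using W(2) M(1,3) finite_same_card_bij by metis
    have V: "verts (induced ?N W) = W" using W(1) by auto
    have "xs \<in> rels (induced ?N W) () \<longleftrightarrow> map f xs \<in> rels M ()" if xs: "set xs \<subseteq> W" for xs
    proof -
      have "xs \<in> rels (induced ?N W) () \<longleftrightarrow> (\<exists>v. xs = [v])"
        using xs W(1) by (auto simp: induced_def marked_hypergraph_def)
      also have "\<dots> \<longleftrightarrow> (\<exists>v\<in>verts M. map f xs = [v])"
        using xs f by (auto simp: map_eq_Cons_conv bij_betw_def)
      finally show ?thesis unfolding M(2) .
    qed
    then have "is_iso f (induced ?N W) M" using f unfolding is_iso_def V by simp
    then show ?thesis unfolding isomorphic_def by blast
  qed
  then have "{W. W \<subseteq> {..<n} \<and> card W = m} \<subseteq> {W. W \<subseteq> verts ?N \<and> card W = card (verts M) \<and> isomorphic (induced ?N W) M}"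
    using M(1) by fastforce
  then have "n choose m \<le> card {W. W \<subseteq> verts ?N \<and> card W = card (verts M) \<and> isomorphic (induced ?N W) M}"
    using card_mono[of "{W. W \<subseteq> verts ?N \<and> card W = card (verts M) \<and> isomorphic (induced ?N W) M}" "{W. W \<subseteq> {..<n} \<and> card W = m}"] n_subsets[of "{..<n}" m] by simp
  moreover have "(real n / real m) ^ m \<le> real (n choose m)" by (rule binomial_ge_n_over_k_pow_k[OF assms(2)])
  ultimately show ?thesis
    unfolding ind_density_def M(1) using assms(1,2) by (simp add: binomial_ratio_ge)
qed

text \<open>One marked vertex and k unmarked ones can be chosen independently, which gives n times
  (n choose k) different sets.\<close>

lemma card_one_marked_ge:
  assumes "k \<ge> 1" "n \<ge> k"
  shows "(real n / real (k + 1)) ^ (k + 1) \<le> real (card {W. W \<subseteq> {..<2 * n} \<and> card W = k + 1 \<and> (\<exists>x. W \<inter> {..<n} = {x})})"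
proof -
  let ?S = "{S. S \<subseteq> {n..<2 * n} \<and> card S = k}"
  let ?T = "{W. W \<subseteq> {..<2 * n} \<and> card W = k + 1 \<and> (\<exists>x. W \<inter> {..<n} = {x})}"
  have fin: "finite ?S" "finite ?T" by auto
  have "inj_on (\<lambda>(x, S). insert x S) ({..<n} \<times> ?S)"
  proof (intro inj_onI, clarify)
    fix x S y S' assume a: "x < n" "S \<subseteq> {n..<2 * n}" "y < n" "S' \<subseteq> {n..<2 * n}" "insert x S = insert y S'"
    have "insert x S \<inter> {..<n} = {x}" "insert y S' \<inter> {..<n} = {y}" using a by auto
    then have "x = y" using a(5) by auto
    moreover have "x \<notin> S" "y \<notin> S'" using a by auto
    ultimately show "x = y \<and> S = S'" using a(5) by (auto simp: insert_ident)
  qed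
  moreover have "(\<lambda>(x, S). insert x S) ` ({..<n} \<times> ?S) \<subseteq> ?T"
  proof (rule image_subsetI)
    fix p assume "p \<in> {..<n} \<times> ?S"
    then obtain x S where p: "p = (x, S)" and a: "x \<in> {..<n}" "S \<subseteq> {n..<2 * n}" "card S = k" by auto
    have "x \<notin> S" "finite S" using a finite_subset by auto
    moreover have "insert x S \<inter> {..<n} = {x}" using a by auto
    ultimately show "(case p of (x, S) \<Rightarrow> insert x S) \<in> ?T"
      unfolding p using a by auto
  qed
  ultimately have "card ({..<n} \<times> ?S) \<le> card ?T" using fin(2) by (rule card_inj_on_le)
  then have "n * (n choose k) \<le> card ?T" using n_subsets[of "{n..<2 * n}" k] by (simp add: card_cartesian_product)
  then have "real n * real (n choose k) \<le> real (card ?T)" unfolding of_nat_mult[symmetric] by (rule of_nat_mono)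
  moreover have "(real n / real (k + 1)) ^ (k + 1) \<le> real n * real (n choose k)"
  proof -
    have "(real n / real (k + 1)) ^ k \<le> (real n / real k) ^ k" 
      using assms(1) by (intro power_mono divide_left_mono) auto
    also have "\<dots> \<le> real (n choose k)" by (rule binomial_ge_n_over_k_pow_k[OF assms(2)])
    finally have "(real n / real (k + 1)) * (real n / real (k + 1)) ^ k \<le> real n * real (n choose k)"
      by (intro mult_mono) (auto simp: field_simps)
    then show ?thesis by simp
  qed
  ultimately show ?thesis by linarith
qed

text \<open>
  Were UInduce to hold, hypergraphs on \<open>k + 1\<close> vertices with coboundary \<open>-1\<close> would have density
  zero, as they do not occur on marked vertices. But they arise from any \<open>k + 1\<close> vertices exactly
  one of which is marked.
\<close>

lemma not_UInduce1:
  fixes k :: nat and D :: "nat \<Rightarrow> nat set set" and q :: "nat \<Rightarrow> nat"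
  defines "N n \<equiv> marked_hypergraph k (q n) (D n)"
  assumes k: "k \<ge> 1" and q: "filterlim q at_top sequentially"
    and \<psi>: "\<psi> \<in> hom_plus (hypergraph_thy 1)" and coup: "coupling (hypergraph_thy k) (hypergraph_thy 1) \<phi> \<psi> \<xi>"
    and lim_\<xi>: "\<And>M. fin_model (union_thy (hypergraph_thy k) (hypergraph_thy 1)) M \<Longrightarrow> 
      (\<lambda>n. ind_density M (N n)) \<longlonglongrightarrow> \<xi> (iso_class (union_thy (hypergraph_thy k) (hypergraph_thy 1)) M)"
    and lim_\<phi>: "\<And>M. fin_model (hypergraph_thy k) M \<Longrightarrow> 
      (\<lambda>n. ind_density M (reductL (N n))) \<longlonglongrightarrow> \<phi> (iso_class (hypergraph_thy k) M)"
    and lim_\<psi>: "\<And>M. fin_model (hypergraph_thy 1) M \<Longrightarrow> 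
      (\<lambda>n. ind_density M (reductR (N n))) \<longlonglongrightarrow> \<psi> (iso_class (hypergraph_thy 1) M)"
  shows "\<not> UInduce1 k \<phi>"
proof
  let ?T = "hypergraph_thy k" and ?T' = "hypergraph_thy 1"
  let ?U = "union_thy ?T ?T'"
  let ?m = "k + 1"
  let ?c = "(1 / (2 * real ?m)) ^ ?m"
  assume "UInduce1 k \<phi>"
  then have UInduce: "\<xi> (iso_class ?U M) = indep_coupling ?T ?T' \<phi> \<psi> M"
    if "fin_model ?U M" "\<And>v. v \<in> verts M \<Longrightarrow> [v] \<in> rels M (Inr ())" for M
    using \<psi> coup that unfolding UInduce1_def Let_def by blast
  have c: "?c > 0" by simp
  have large: "\<exists>n0. \<forall>n\<ge>n0. q n \<ge> ?m" 
    using q unfolding filterlim_at_top eventually_sequentially by blast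
  have zero: "\<phi> (iso_class ?T G) = 0" if G: "fin_model ?T G" "card (verts G) = ?m" "coboundary G = -1" for G
  proof -
    \<comment> \<open>\<open>G\<close> with all vertices marked: a structure to which UInduce
      applies and which never occurs in \<open>N n\<close>.\<close>
    define M where "M = \<lparr>verts = verts G, rels = case_sum (\<lambda>_::unit. rels G ()) (\<lambda>_::unit. {[v] |v. v \<in> verts G})\<rparr>"
    have L: "reductL M = G" by (simp add: M_def reductL_def)
    have V: "verts M = verts G" by (simp add: M_def)
    have R: "fin_model ?T' (reductR M)" using G(1)
      by (auto simp: M_def reductR_def fin_model_def model_def is_structure_def hypergraph_thy_def)
    have M: "fin_model ?U M" unfolding fin_model_union_iff L using G(1) R by simp
    have marked: "[v] \<in> rels M (Inr ())" if "v \<in> verts M" for v using that by (simp add: M_def)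
    have fin: "finite (verts M)" using G(1) by (simp add: V fin_model_def)
    have "ind_density M (N n) = 0" for n
    proof -
      have "\<not> isomorphic (induced (N n) W) M" if "W \<subseteq> verts (N n)" for W
        using coboundary_of_marked_copy[OF k _ marked, of W "q n" "D n"] that G(2,3) unfolding N_def L V by auto
      then show ?thesis unfolding ind_density_def by (auto simp: card_eq_0_iff)
    qed
    then have "\<xi> (iso_class ?U M) = 0" using LIMSEQ_unique[OF lim_\<xi>[OF M], of 0] by simp
    then have "labelled ?T \<phi> G * labelled ?T' \<psi> (reductR M) = 0"
      using UInduce[OF M marked] card_aut_pos[OF fin] unfolding indep_coupling_def L by simp
    moreover have "\<psi> (iso_class ?T' (reductR M)) > 0"
    proof -
      obtain n0 where n0: "\<And>n. n \<ge> n0 \<Longrightarrow> q n \<ge> ?m" using large by blast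
      have "?c \<le> ind_density (reductR M) (reductR (N n))" if "n \<ge> n0" for n
        unfolding N_def using n0[OF that] G(2) fin by (intro density_all_marked_ge) (auto simp: V M_def)
      then have "?c \<le> \<psi> (iso_class ?T' (reductR M))"
        by (intro LIMSEQ_le_const[OF lim_\<psi>[OF R]]) blast
      then show ?thesis using c by linarith
    qed
    \<comment> \<open>Labelled values are positive multiples of unlabelled ones, and the factor from
      \<open>\<psi>\<close> is positive, so the factor from \<open>\<phi>\<close> must
      vanish.\<close>
    ultimately show ?thesis
      using card_aut_pos[of "reductR M"] card_aut_pos[of G] fin G(1) by (simp add: labelled_def fin_model_def)
  qed
  define F where "F C = (of_bool (\<exists>G\<in>C. coboundary G = -1) :: real)" for C
  have F: "F (iso_class ?T G) = of_bool (coboundary G = -1)" if "fin_model ?T G" for G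
  proof -
    have "(\<exists>G'\<in>iso_class ?T G. coboundary G' = -1) \<longleftrightarrow> coboundary G = -1"
      using that coboundary_cong isomorphic_refl[of G] unfolding mem_iso_class Bex_def by metis
    then show ?thesis by (simp add: F_def)
  qed
  have "F C * \<phi> C = 0" if "C \<in> classes ?T ?m" for C
    using that F zero unfolding classes_def by auto
  then have "(\<Sum>C\<in>classes ?T ?m. F C * \<phi> C) = 0" by (rule sum.neutral[OF ballI])
  moreover have "(\<lambda>n. (\<Sum>W\<in>sub ?m (reductL (N n)). F (iso_class ?T (induced (reductL (N n)) W))) / 
      real (card (verts (reductL (N n))) choose ?m)) \<longlonglongrightarrow> (\<Sum>C\<in>classes ?T ?m. F C * \<phi> C)"
    using fin_model_marked_hypergraph[of k "q n" "D n" for n]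
    by (intro subset_average_tendsto[OF hereditary_hypergraph _ lim_\<phi>]) (simp_all add: N_def fin_model_union_iff)
  moreover have "\<exists>n0. \<forall>n\<ge>n0. ?c \<le> (\<Sum>W\<in>sub ?m (reductL (N n)). F (iso_class ?T (induced (reductL (N n)) W))) / 
      real (card (verts (reductL (N n))) choose ?m)"
  proof -
    have "?c \<le> (\<Sum>W\<in>sub ?m (reductL (N n)). F (iso_class ?T (induced (reductL (N n)) W))) / 
      real (card (verts (reductL (N n))) choose ?m)" if n: "q n \<ge> ?m" for n
    proof -
      \<comment> \<open>These subsets all have coboundary -1 and alone account for the density
        \<open>?c\<close>, contradicting the limit zero.\<close>
      let ?S = "{W. W \<subseteq> {..<2 * q n} \<and> card W = ?m \<and> (\<exists>x. W \<inter> {..<q n} = {x})}"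
      have N: "fin_model ?T (reductL (N n))" 
        using fin_model_marked_hypergraph unfolding N_def fin_model_union_iff by blast
      have "real (card ?S) = (\<Sum>W\<in>?S. F (iso_class ?T (induced (reductL (N n)) W)))"
      proof -
        have "F (iso_class ?T (induced (reductL (N n)) W)) = 1" if "W \<in> ?S" for W
        proof -
          have "coboundary (induced (reductL (N n)) W) = -1"
            using that unfolding N_def by (auto intro: coboundary_one_marked)
          moreover have "fin_model ?T (induced (reductL (N n)) W)"
            using that by (intro sub_facts(1)[OF hereditary_hypergraph N, of _ ?m]) (simp add: N_def)
          ultimately show ?thesis using F by simp
        qed
        then show ?thesis by simp
      qed
      also have "\<dots> \<le> (\<Sum>W\<in>sub ?m (reductL (N n)). F (iso_class ?T (induced (reductL (N n)) W)))"
        by (rule sum_mono2) (auto simp: N_def F_def)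
      finally have "real (card ?S) \<le> (\<Sum>W\<in>sub ?m (reductL (N n)). F (iso_class ?T (induced (reductL (N n)) W)))" .
      moreover have "(real (q n) / real ?m) ^ ?m \<le> real (card ?S)"
        using n by (intro card_one_marked_ge k) simp
      ultimately have "(real (q n) / real ?m) ^ ?m \<le> (\<Sum>W\<in>sub ?m (reductL (N n)). F (iso_class ?T (induced (reductL (N n)) W)))"
        by linarith
      moreover have "card (verts (reductL (N n))) = 2 * q n" by (simp add: N_def)
      ultimately show ?thesis using binomial_ratio_ge[of ?m "q n"] n by (simp only:)
    qed
    then show ?thesis using large by blast
  qed
  ultimately have "?c \<le> 0" using LIMSEQ_le_const by fastforce
  then show False using c by linarith
qed

theorem theorem3p15:
  fixes k :: nat
  assumes "k \<ge> 1"
  shows "\<exists>\<phi> \<in> hom_plus (hypergraph_thy k). Dev_km1 k \<phi> \<and> \<not> UInduce1 k \<phi>"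
proof -
  let ?T = "hypergraph_thy k" and ?T' = "hypergraph_thy 1"
  have "\<exists>D. (\<Sum>W\<in>sub (2 * k) (reductL (marked_hypergraph k (Suc n) D)). 
     octahedron_sum k (induced (reductL (marked_hypergraph k (Suc n) D)) W)) \<le> 0" for n
    by (rule ex_nonpositive_octahedron_sum[OF assms]) blast
  then obtain D where D: "\<And>n. (\<Sum>W\<in>sub (2 * k) (reductL (marked_hypergraph k (Suc n) (D n))). 
     octahedron_sum k (induced (reductL (marked_hypergraph k (Suc n) (D n))) W)) \<le> 0"
    by metis
  define N where "N n = marked_hypergraph k (Suc n) (D n)" for n
  have N: "fin_model (union_thy ?T ?T') (N n)" for n
    unfolding N_def by (rule fin_model_marked_hypergraph)
  have "strict_mono (\<lambda>n. card (verts (N n)))" by (simp add: N_def strict_mono_def)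
  \<comment> \<open>The limit \<open>\<psi>\<close> of the marked sets and the joint limit
    \<open>\<xi>\<close> are the witnesses against UInduce for this \<open>\<phi>\<close>.\<close>
  then obtain r \<phi> \<psi> \<xi> where r: "strict_mono r" and \<phi>: "\<phi> \<in> hom_plus ?T" and \<psi>: "\<psi> \<in> hom_plus ?T'" 
    and coup: "coupling ?T ?T' \<phi> \<psi> \<xi>"
    and lim_\<xi>: "\<And>M. fin_model (union_thy ?T ?T') M \<Longrightarrow> 
      (\<lambda>n. ind_density M (N (r n))) \<longlonglongrightarrow> \<xi> (iso_class (union_thy ?T ?T') M)"
    and lim_\<phi>: "\<And>M. fin_model ?T M \<Longrightarrow> (\<lambda>n. ind_density M (reductL (N (r n)))) \<longlonglongrightarrow> \<phi> (iso_class ?T M)"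
    and lim_\<psi>: "\<And>M. fin_model ?T' M \<Longrightarrow> (\<lambda>n. ind_density M (reductR (N (r n)))) \<longlonglongrightarrow> \<psi> (iso_class ?T' M)"
    by (rule coupling_of_sequence[OF hereditary_hypergraph hereditary_hypergraph N]) (rule that)
  have "Dev_km1 k \<phi>"
  proof (cases "k = 1")
    case True
    then show ?thesis using Dev_1 by simp
  next
    case False
    then have "k \<ge> 2" using assms by simp
    moreover have "fin_model ?T (reductL (N n))" for n using N by (simp add: fin_model_union_iff)
    ultimately show ?thesis
      using D by (intro Dev_of_octahedron_sum[of k "\<lambda>n. reductL (N (r n))"] lim_\<phi>) (simp_all add: N_def)
  qed
  moreover have "\<not> UInduce1 k \<phi>"
  proof (rule not_UInduce1[OF assms _ \<psi> coup, where q="\<lambda>n. Suc (r n)" and D="\<lambda>n. D (r n)"])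
    show "filterlim (\<lambda>n. Suc (r n)) at_top sequentially"
      using filterlim_compose[OF filterlim_Suc filterlim_subseq[OF r]] .
  qed (use lim_\<xi> lim_\<phi> lim_\<psi> in \<open>simp_all add: N_def\<close>)
  ultimately show ?thesis using \<phi> by blast
qed

end
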